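(* Let $M$ be an EMV-algebra. Then the state space $\mathcal S(M)$ is a simplex. Moreover, the following are equivalent: (i) $M$ has a top element; (ii) $\mathcal S(M)$ is a Choquet simplex; (iii) $\mathcal S(M)$ is a Bauer simplex.
   Context: An EMV-algebra is an algebra $(M;\vee,\wedge,\oplus,0)$ of type $\langle 2,2,2,0\rangle$ such that: (i) $(M;\oplus,0)$ is a commutative monoid with neutral element $0$; (ii) $(M;\vee,\wedge,0)$ is a distributive lattice with bottom $0$ (order $\le$); (iii) for each idempotent $a$ ($a\oplus a=a$; set $\mathcal I(M)$), $([0,a];\oplus,\lambda_a,0,a)$ is an MV-algebra, where $[0,a]=\{x:0\le x\le a\}$ and $\lambda_a(x)=\min\{z\in[0,a]:z\oplus x=a\}$; (iv) each element lies below some idempotent. A top element is a greatest element of $M$. For $x,y\le a\in\mathcal I(M)$, $x\odot y=\lambda_a(\lambda_a(x)\oplus\lambda_a(y))$; $x+y$ is defined iff $x\odot y=0$, then $x+y=x\oplus y$. A state is a map $s:M\to[0,1]$ with $s(x+y)=s(x)+s(y)$ whenever $x+y$ is defined and $s(a)=1$ for some $a$; $\mathcal S(M)\subseteq\mathbb R^M$ is the set of states, with the topology induced by the product topology of $\mathbb R^M$. A convex cone $C$ in a real vector space $V$ is strict if $C\cap -C=\{0\}$; it defines the order $x\le_C y$ iff $y-x\in C$; a lattice cone is a strict convex cone that is a lattice under $\le_C$. A base of a convex cone $C$ is a convex $K\subseteq C$ such that each non-zero $y\in C$ is uniquely $y=\alpha x$ with $\alpha>0$, $x\in K$. A simplex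 is a convex set affinely isomorphic to a base of a lattice cone in some real vector space. A simplex $K$ in a locally convex Hausdorff space is Choquet if $K$ is compact, and Bauer if both $K$ and its set $\partial K$ of extreme points are compact. *)

theory Defs
  imports "HOL-Analysis.Analysis" "HOL-Library.Function_Algebras"
begin

section \<open>EMV-algebras\<close>

locale mv_algebra =
  fixes A :: "'a set"
    and add :: "'a \<Rightarrow> 'a \<Rightarrow> 'a" (infixl "\<boxplus>" 65)
    and neg :: "'a \<Rightarrow> 'a"
    and z :: 'a
    and u :: 'a
  assumes add_closed: "x \<in> A \<Longrightarrow> y \<in> A \<Longrightarrow> x \<boxplus> y \<in> A"
    and neg_closed: "x \<in> A \<Longrightarrow> neg x \<in> A"
    and zero_closed: "z \<in> A"
    and unit_eq: "u = neg z"
    and add_assoc: "x \<in> A \<Longrightarrow> y \<in> A \<Longrightarrow> w \<in> A \<Longrightarrow> (x \<boxplus> y) \<boxplus> w = x \<boxplus> (y \<boxplus> w)"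
    and add_comm: "x \<in> A \<Longrightarrow> y \<in> A \<Longrightarrow> x \<boxplus> y = y \<boxplus> x"
    and add_zero: "x \<in> A \<Longrightarrow> x \<boxplus> z = x"
    and neg_neg: "x \<in> A \<Longrightarrow> neg (neg x) = x"
    and add_unit: "x \<in> A \<Longrightarrow> x \<boxplus> u = u"
    and mv_axiom: "x \<in> A \<Longrightarrow> y \<in> A \<Longrightarrow>
      neg (neg x \<boxplus> y) \<boxplus> y = neg (neg y \<boxplus> x) \<boxplus> x"

text \<open>The lattice operations of an EMV-algebra are \<^const>\<open>sup\<close> and \<^const>\<open>inf\<close>, so the type
  itself is the underlying set.\<close>

class emv_signature = distrib_lattice + zero +
  fixes oplus :: "'a \<Rightarrow> 'a \<Rightarrow> 'a" (infixl "\<oplus>" 65)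
begin

definition idempotent :: "'a \<Rightarrow> bool"
  where "idempotent a \<longleftrightarrow> a \<oplus> a = a"

definition lam :: "'a \<Rightarrow> 'a \<Rightarrow> 'a"
  where "lam a x = (LEAST z. z \<in> {0..a} \<and> z \<oplus> x = a)"

definition odot :: "'a \<Rightarrow> 'a \<Rightarrow> 'a \<Rightarrow> 'a"
  where "odot a x y = lam a (lam a x \<oplus> lam a y)"

end

text \<open>\<open>lam_exists\<close> says that the minimum defining \<^const>\<open>lam\<close> is attained; otherwise
  \<^const>\<open>lam\<close> would be an unspecified value.\<close>

class emv_algebra = emv_signature +
  assumes oplus_assoc: "(x \<oplus> y) \<oplus> w = x \<oplus> (y \<oplus> w)"
    and oplus_commute: "x \<oplus> y = y \<oplus> x"
    and oplus_zero: "x \<oplus> 0 = x"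
    and zero_least: "0 \<le> x"
    and lam_exists: "idempotent a \<Longrightarrow> x \<in> {0..a} \<Longrightarrow>
      \<exists>z. z \<in> {0..a} \<and> z \<oplus> x = a \<and> (\<forall>w. w \<in> {0..a} \<and> w \<oplus> x = a \<longrightarrow> z \<le> w)"
    and mv_interval: "idempotent a \<Longrightarrow> mv_algebra {0..a} (\<oplus>) (lam a) 0 a"
    and below_idempotent: "\<exists>a. idempotent a \<and> x \<le> a"

section \<open>States\<close>

text \<open>The partial sum \<open>x + y\<close> is defined iff \<open>summable_pair x y\<close>, and then equals \<open>x \<oplus> y\<close>.
  The value of \<^const>\<open>odot\<close> does not depend on the idempotent above \<open>x\<close> and \<open>y\<close>.\<close>

definition summable_pair :: "'a::emv_algebra \<Rightarrow> 'a \<Rightarrow> bool"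
  where "summable_pair x y \<longleftrightarrow> (\<exists>a. idempotent a \<and> x \<le> a \<and> y \<le> a \<and> odot a x y = 0)"

definition emv_state :: "('a::emv_algebra \<Rightarrow> real) \<Rightarrow> bool"
  where "emv_state s \<longleftrightarrow>
    range s \<subseteq> {0..1} \<and>
    (\<forall>x y. summable_pair x y \<longrightarrow> s (x \<oplus> y) = s x + s y) \<and>
    (\<exists>a. s a = 1)"

definition state_space :: "('a::emv_algebra \<Rightarrow> real) set"
  where "state_space = {s. emv_state s}"

section \<open>Locally convex Hausdorff spaces\<close>

text \<open>The Hausdorff property and convexity are spelled out: \<^class>\<open>t2_space\<close> cannot be instantiated for
  all function types (it clashes with the library's metric on functions of a countable argument),
  and a class specification cannot refer to \<^const>\<open>convex\<close>.\<close>

class locally_convex_t2_space = real_vector + topological_ab_group_add +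
  assumes t2_separation: "x \<noteq> y \<Longrightarrow> \<exists>U V. open U \<and> open V \<and> x \<in> U \<and> y \<in> V \<and> U \<inter> V = {}"
    and tendsto_scaleR_nhds:
    "LIM p (nhds c \<times>\<^sub>F nhds x). fst p *\<^sub>R snd p :> nhds (c *\<^sub>R x)"
    and convex_nhds_expl: "open U \<Longrightarrow> x \<in> U \<Longrightarrow> \<exists>V. open V \<and> x \<in> V \<and> V \<subseteq> U \<and>
    (\<forall>x\<in>V. \<forall>y\<in>V. \<forall>u\<ge>0. \<forall>v\<ge>0. u + v = 1 \<longrightarrow> u *\<^sub>R x + v *\<^sub>R y \<in> V)"

lemma convex_nhds:
  fixes x :: "'a::locally_convex_t2_space"
  assumes "open U" "x \<in> U"
  shows "\<exists>V. open V \<and> convex V \<and> x \<in> V \<and> V \<subseteq> U"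
  using convex_nhds_expl[OF assms] unfolding convex_def by blast

instance real :: locally_convex_t2_space
proof
  fix x y :: real assume "x \<noteq> y"
  then show "\<exists>U V. open U \<and> open V \<and> x \<in> U \<and> y \<in> V \<and> U \<inter> V = {}" by (rule hausdorff)
next
  fix c x :: real
  show "LIM p (nhds c \<times>\<^sub>F nhds x). fst p *\<^sub>R snd p :> nhds (c *\<^sub>R x)"
    by (intro tendsto_scaleR filterlim_fst filterlim_snd)
next
  fix U :: "real set" and x assume "open U" "x \<in> U"
  then obtain e where "e > 0" "ball x e \<subseteq> U" by (auto simp: open_contains_ball)
  then show "\<exists>V. open V \<and> x \<in> V \<and> V \<subseteq> U \<and>
    (\<forall>x\<in>V. \<forall>y\<in>V. \<forall>u\<ge>0. \<forall>v\<ge>0. u + v = 1 \<longrightarrow> u *\<^sub>R x + v *\<^sub>R y \<in> V)"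
    using convex_ball[of x e] unfolding convex_def
    by (intro exI[of _ "ball x e"]) auto
qed

text \<open>The topology of a function space is the product topology of \<^theory>\<open>HOL-Analysis.Function_Topology\<close>.\<close>

instantiation "fun" :: (type, real_vector) real_vector
begin

definition scaleR_fun :: "real \<Rightarrow> ('a \<Rightarrow> 'b) \<Rightarrow> 'a \<Rightarrow> 'b"
  where "scaleR_fun c f = (\<lambda>x. c *\<^sub>R f x)"

instance
  by standard (auto simp: scaleR_fun_def fun_eq_iff scaleR_add_right scaleR_add_left)

end

lemma scaleR_fun_apply [simp]: "(c *\<^sub>R f) x = c *\<^sub>R f x"
  by (simp add: scaleR_fun_def)

lemma tendsto_fun_iff:
  fixes g :: "'c \<Rightarrow> 'a \<Rightarrow> 'b::topological_space"
  shows "(g \<longlongrightarrow> l) F \<longleftrightarrow> (\<forall>i. ((\<lambda>x. g x i) \<longlongrightarrow> l i) F)"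
  using limitin_componentwise[of "\<lambda>_. euclidean :: 'b topology" "UNIV :: 'a set" g l F]
  by (simp add: euclidean_product_topology)

lemma tendsto_fun_app: "(g \<longlongrightarrow> l) F \<Longrightarrow> ((\<lambda>x. g x i) \<longlongrightarrow> l i) F"
  for g :: "'c \<Rightarrow> 'a \<Rightarrow> 'b::topological_space"
  by (simp only: tendsto_fun_iff)

instance "fun" :: (type, topological_ab_group_add) topological_ab_group_add
proof
  fix a b :: "'a \<Rightarrow> 'b"
  show "LIM x (nhds a \<times>\<^sub>F nhds b). fst x + snd x :> nhds (a + b)"
    unfolding tendsto_fun_iff plus_fun_apply
    by (intro allI tendsto_add tendsto_fun_app[OF filterlim_fst] tendsto_fun_app[OF filterlim_snd])
  show "(uminus \<longlongrightarrow> - a) (nhds a)"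
    unfolding tendsto_fun_iff uminus_apply
    by (intro allI tendsto_minus tendsto_fun_app[OF filterlim_ident])
qed

instance "fun" :: (type, locally_convex_t2_space) locally_convex_t2_space
proof
  fix f g :: "'a \<Rightarrow> 'b" assume "f \<noteq> g"
  then obtain i where "f i \<noteq> g i" by auto
  then obtain U V where UV: "open U" "open V" "f i \<in> U" "g i \<in> V" "U \<inter> V = {}"
    using t2_separation[OF \<open>f i \<noteq> g i\<close>] by (elim exE conjE)
  have op: "open ((\<lambda>h::'a \<Rightarrow> 'b. h i) -` W)" if "open W" for W
    by (rule open_vimage[OF that continuous_on_product_coordinates])
  show "\<exists>U V. open U \<and> open V \<and> f \<in> U \<and> g \<in> V \<and> U \<inter> V = {}"
    using UV op[OF UV(1)] op[OF UV(2)]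
    by (intro exI[of _ "(\<lambda>h. h i) -` U"] exI[of _ "(\<lambda>h. h i) -` V"]) auto
next
  fix c :: real and f :: "'a \<Rightarrow> 'b"
  show "LIM p (nhds c \<times>\<^sub>F nhds f). fst p *\<^sub>R snd p :> nhds (c *\<^sub>R f)"
    unfolding tendsto_fun_iff scaleR_fun_apply
  proof
    fix i
    have "LIM p (nhds c \<times>\<^sub>F nhds f). (fst p, snd p i) :> (nhds c \<times>\<^sub>F nhds (f i))"
      by (rule filterlim_Pair[OF filterlim_fst tendsto_fun_app[OF filterlim_snd]])
    from filterlim_compose[OF tendsto_scaleR_nhds this]
    show "LIM p (nhds c \<times>\<^sub>F nhds f). fst p *\<^sub>R snd p i :> nhds (c *\<^sub>R f i)" by simp
  qed
next
  fix U :: "('a \<Rightarrow> 'b) set" and f assume "open U" "f \<in> U"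
  then obtain X where X: "f \<in> (\<Pi>\<^sub>E i\<in>UNIV. X i)" "\<And>i. open (X i)" "finite {i. X i \<noteq> UNIV}"
      "(\<Pi>\<^sub>E i\<in>UNIV. X i) \<subseteq> U"
    using product_topology_open_contains_basis[OF _ \<open>f \<in> U\<close>, of "\<lambda>_. euclidean" UNIV]
    unfolding open_fun_def by auto
  have "\<forall>i. \<exists>V. open V \<and> convex V \<and> f i \<in> V \<and> V \<subseteq> X i \<and> (X i = UNIV \<longrightarrow> V = UNIV)"
  proof
    fix i
    have "f i \<in> X i" using X(1) by auto
    then show "\<exists>V. open V \<and> convex V \<and> f i \<in> V \<and> V \<subseteq> X i \<and> (X i = UNIV \<longrightarrow> V = UNIV)"
      using convex_nhds[OF X(2)[of i], of "f i"] by (cases "X i = UNIV") (auto intro!: exI[of _ UNIV])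
  qed
  then obtain V where V: "\<And>i. open (V i)" "\<And>i. convex (V i)" "\<And>i. f i \<in> V i"
      "\<And>i. V i \<subseteq> X i" "\<And>i. X i = UNIV \<Longrightarrow> V i = UNIV"
    by metis
  have "finite {i. V i \<noteq> UNIV}"
    by (rule finite_subset[OF _ X(3)]) (use V(5) in auto)
  then have "open (\<Pi>\<^sub>E i\<in>UNIV. V i)"
    using V(1) by (intro open_PiE) auto
  moreover have "convex (\<Pi>\<^sub>E i\<in>UNIV. V i)"
    using V(2) by (auto simp: convex_def PiE_iff)
  moreover have "f \<in> (\<Pi>\<^sub>E i\<in>UNIV. V i)" using V(3) by auto
  moreover have "(\<Pi>\<^sub>E i\<in>UNIV. V i) \<subseteq> U" using V(4) X(4) by (auto simp: PiE_iff subset_iff)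
  ultimately show "\<exists>V. open V \<and> f \<in> V \<and> V \<subseteq> U \<and>
    (\<forall>x\<in>V. \<forall>y\<in>V. \<forall>u\<ge>0. \<forall>v\<ge>0. u + v = 1 \<longrightarrow> u *\<^sub>R x + v *\<^sub>R y \<in> V)"
    unfolding convex_def by blast
qed

section \<open>Simplices\<close>

definition cone_le :: "'v::real_vector set \<Rightarrow> 'v \<Rightarrow> 'v \<Rightarrow> bool"
  where "cone_le C x y \<longleftrightarrow> y - x \<in> C"

definition strict_cone :: "'v::real_vector set \<Rightarrow> bool"
  where "strict_cone C \<longleftrightarrow> C \<inter> uminus ` C = {0}"

definition lattice_cone :: "'v::real_vector set \<Rightarrow> bool"
  where "lattice_cone C \<longleftrightarrow> convex_cone C \<and> strict_cone C \<and>
    (\<forall>x\<in>C. \<forall>y\<in>C.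
      (\<exists>z\<in>C. cone_le C x z \<and> cone_le C y z \<and>
        (\<forall>w\<in>C. cone_le C x w \<and> cone_le C y w \<longrightarrow> cone_le C z w)) \<and>
      (\<exists>z\<in>C. cone_le C z x \<and> cone_le C z y \<and>
        (\<forall>w\<in>C. cone_le C w x \<and> cone_le C w y \<longrightarrow> cone_le C w z)))"

definition base_of_cone :: "'v::real_vector set \<Rightarrow> 'v set \<Rightarrow> bool"
  where "base_of_cone C B \<longleftrightarrow> convex B \<and> B \<subseteq> C \<and>
    (\<forall>y\<in>C - {0}. \<exists>!(\<alpha>, x). \<alpha> > 0 \<and> x \<in> B \<and> y = \<alpha> *\<^sub>R x)"

definition affinely_isomorphic :: "'v::real_vector set \<Rightarrow> 'w::real_vector set \<Rightarrow> bool"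
  where "affinely_isomorphic K B \<longleftrightarrow> (\<exists>f. bij_betw f K B \<and>
    (\<forall>x\<in>K. \<forall>y\<in>K. \<forall>t\<in>{0..1}.
      f ((1 - t) *\<^sub>R x + t *\<^sub>R y) = (1 - t) *\<^sub>R f x + t *\<^sub>R f y))"

text \<open>HOL cannot quantify over the vector space containing the cone, so it is fixed to be
  \<open>'v \<times> real\<close>. By \<open>is_simplexI\<close> below, a cone in any other real vector space would do as well.\<close>

definition is_simplex :: "'v::real_vector set \<Rightarrow> bool"
  where "is_simplex K \<longleftrightarrow> convex K \<and>
    (\<exists>(C :: ('v \<times> real) set) B.
      lattice_cone C \<and> base_of_cone C B \<and> affinely_isomorphic K B)"

definition choquet_simplex :: "'v::locally_convex_t2_space set \<Rightarrow> bool"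
  where "choquet_simplex K \<longleftrightarrow> is_simplex K \<and> compact K"

definition bauer_simplex :: "'v::locally_convex_t2_space set \<Rightarrow> bool"
  where "bauer_simplex K \<longleftrightarrow> is_simplex K \<and> compact K \<and> compact {x. x extreme_point_of K}"

lemma base_of_cone_uniq:
  assumes "base_of_cone C B" "a > 0" "b > 0" "x \<in> B" "y \<in> B" "a *\<^sub>R x = b *\<^sub>R y"
    "a *\<^sub>R x \<in> C" "x \<noteq> 0"
  shows "a = b \<and> x = y"
proof -
  have "a *\<^sub>R x \<in> C - {0}" using assms by auto
  then have "\<exists>!(\<alpha>, v). \<alpha> > 0 \<and> v \<in> B \<and> a *\<^sub>R x = \<alpha> *\<^sub>R v"
    using assms(1) unfolding base_of_cone_def by blast
  then show ?thesis
    using assms(2-6) by (metis (mono_tags, lifting) case_prodI prod.inject)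
qed

lemma base_of_cone_ex:
  assumes "base_of_cone C B" "y \<in> C" "y \<noteq> 0"
  shows "\<exists>a b. a > 0 \<and> b \<in> B \<and> y = a *\<^sub>R b"
proof -
  have "y \<in> C - {0}" using assms by auto
  then have "\<exists>!(\<alpha>, v). \<alpha> > 0 \<and> v \<in> B \<and> y = \<alpha> *\<^sub>R v"
    using assms(1) unfolding base_of_cone_def by blast
  from ex1_implies_ex[OF this] show ?thesis by auto
qed

lemma is_simplexI_nonzero:
  fixes K :: "'v::real_vector set" and C :: "'w::real_vector set"
  assumes K: "convex K" and lat: "lattice_cone C" and base: "base_of_cone C B"
    and bij: "bij_betw f K B" and nz: "0 \<notin> B"
    and aff: "\<And>x y t. x \<in> K \<Longrightarrow> y \<in> K \<Longrightarrow> 0 \<le> t \<Longrightarrow> t \<le> 1 \<Longrightarrow>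
      f ((1 - t) *\<^sub>R x + t *\<^sub>R y) = (1 - t) *\<^sub>R f x + t *\<^sub>R f y"
  shows "is_simplex K"
proof -
  define D :: "('v \<times> real) set" where "D = insert 0 {(a *\<^sub>R k, a) | a k. a > 0 \<and> k \<in> K}"
  define h :: "'v \<times> real \<Rightarrow> 'w"
    where "h p = snd p *\<^sub>R f (inverse (snd p) *\<^sub>R fst p)" for p
  have cc: "convex_cone C" using lat by (simp add: lattice_cone_def)
  have fB: "f k \<in> B" if "k \<in> K" for k using bij that by (auto simp: bij_betw_def)
  have BC: "B \<subseteq> C" using base by (simp add: base_of_cone_def)
  have h0 [simp]: "h 0 = 0" by (simp add: h_def)
  have hk [simp]: "h (a *\<^sub>R k, a) = a *\<^sub>R f k" if "a > 0" for a k
    using that by (simp add: h_def)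
  have Dk: "(a *\<^sub>R k, a) \<in> D" if "a > 0" "k \<in> K" for a k using that by (auto simp: D_def)
  have D0: "0 \<in> D" by (simp add: D_def)
  have Dcases: "p = 0 \<or> (\<exists>a k. p = (a *\<^sub>R k, a) \<and> a > 0 \<and> k \<in> K)" if "p \<in> D" for p
    using that by (auto simp: D_def)
  have add: "p + q \<in> D \<and> h (p + q) = h p + h q" if pq: "p \<in> D" "q \<in> D" for p q
  proof (cases "p = 0 \<or> q = 0")
    case True then show ?thesis using pq by auto
  next
    case False
    then obtain a k b l where ak: "p = (a *\<^sub>R k, a)" "a > 0" "k \<in> K"
      and bl: "q = (b *\<^sub>R l, b)" "b > 0" "l \<in> K" using Dcases[OF pq(1)] Dcases[OF pq(2)] by blast
    define t where "t = b / (a + b)"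
    have t: "0 \<le> t" "t \<le> 1" "(a + b) * (1 - t) = a" "(a + b) * t = b"
      using ak bl by (auto simp: t_def field_simps)
    define m where "m = (1 - t) *\<^sub>R k + t *\<^sub>R l"
    have mK: "m \<in> K" unfolding m_def using K ak bl t by (auto simp: convex_alt)
    have s: "p + q = ((a + b) *\<^sub>R m, a + b)"
      by (simp only: ak bl m_def scaleR_add_right scaleR_scaleR t(3) t(4) add_Pair)
    have "h (p + q) = (a + b) *\<^sub>R f m" unfolding s using ak bl by simp
    also have "\<dots> = (a + b) *\<^sub>R ((1 - t) *\<^sub>R f k + t *\<^sub>R f l)"
      unfolding m_def using aff ak bl t by simp
    also have "\<dots> = a *\<^sub>R f k + b *\<^sub>R f l"
      by (simp only: scaleR_add_right scaleR_scaleR t(3) t(4))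
    also have "\<dots> = h p + h q" using ak bl by simp
    finally show ?thesis using s Dk[of "a + b" m] mK ak bl by simp
  qed
  have scale: "c *\<^sub>R p \<in> D" if cp: "c \<ge> 0" "p \<in> D" for c p
  proof (cases "c = 0 \<or> p = 0")
    case True then show ?thesis using D0 by auto
  next
    case False
    then obtain a k where "p = (a *\<^sub>R k, a)" "a > 0" "k \<in> K" using Dcases[OF cp(2)] by blast
    then show ?thesis using Dk[of "c * a" k] False cp by simp
  qed
  have hC: "h p \<in> C" if "p \<in> D" for p
    using Dcases[OF that] fB BC convex_cone_scaleR[OF cc] cc
    by (auto simp: convex_cone_contains_0 subset_iff)
  have surj: "\<exists>p\<in>D. h p = y" if "y \<in> C" for y
  proof (cases "y = 0")
    case True then show ?thesis using D0 h0 by blast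
  next
    case False
    then obtain a b where ab: "a > 0" "b \<in> B" "y = a *\<^sub>R b"
      using base_of_cone_ex[OF base \<open>y \<in> C\<close>] by blast
    then obtain k where "k \<in> K" "b = f k" using bij by (auto simp: bij_betw_def)
    then show ?thesis using ab Dk[of a k] by (intro bexI[of _ "(a *\<^sub>R k, a)"]) auto
  qed
  have inj: "p = q" if pq: "p \<in> D" "q \<in> D" "h p = h q" for p q
  proof -
    have fnz: "f k \<noteq> 0" if "k \<in> K" for k using fB[OF that] nz by metis
    have nz': "h r \<noteq> 0" if "r \<in> D" "r \<noteq> 0" for r
      using Dcases[OF that(1)] that(2) fnz by auto
    show ?thesis
    proof (cases "p = 0 \<or> q = 0")
      case True then show ?thesis using nz'[OF pq(1)] nz'[OF pq(2)] pq(3) h0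
        by (cases "p = 0"; cases "q = 0") auto
    next
      case False
      then obtain a k b l where ak: "p = (a *\<^sub>R k, a)" "a > 0" "k \<in> K"
        and bl: "q = (b *\<^sub>R l, b)" "b > 0" "l \<in> K" using Dcases[OF pq(1)] Dcases[OF pq(2)] by blast
      have "f k \<noteq> 0" using fnz ak by blast
      then have "a = b \<and> f k = f l"
        using base_of_cone_uniq[OF base, of a b "f k" "f l"] ak bl pq fB hC[OF pq(1)] by auto
      then have "k = l" using bij ak bl by (auto simp: bij_betw_def inj_on_def)
      with \<open>a = b \<and> f k = f l\<close> ak bl show ?thesis by simp
    qed
  qed
  have le: "cone_le D p q \<longleftrightarrow> cone_le C (h p) (h q)" if pq: "p \<in> D" "q \<in> D" for p q
  proof
    assume "cone_le D p q"
    then have "q - p \<in> D" by (simp add: cone_le_def)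
    with add[OF pq(1) this] hC[OF this] show "cone_le C (h p) (h q)"
      by (simp add: cone_le_def)
  next
    assume "cone_le C (h p) (h q)"
    then obtain r where r: "r \<in> D" "h r = h q - h p"
      using surj[of "h q - h p"] by (auto simp: cone_le_def)
    have pr: "p + r \<in> D" "h (p + r) = h p + h r" using add[OF pq(1) r(1)] by blast+
    have "q = p + r" by (rule inj[OF pq(2) pr(1)]) (simp only: pr(2) r(2) add_diff_cancel_left' diff_add_cancel add.commute[of "h p"])
    then show "cone_le D p q" using r(1) by (simp add: cone_le_def)
  qed
  have lat_sup: "\<forall>x\<in>C. \<forall>y\<in>C. \<exists>z\<in>C. cone_le C x z \<and> cone_le C y z \<and>
        (\<forall>w\<in>C. cone_le C x w \<and> cone_le C y w \<longrightarrow> cone_le C z w)"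
    and lat_inf: "\<forall>x\<in>C. \<forall>y\<in>C. \<exists>z\<in>C. cone_le C z x \<and> cone_le C z y \<and>
        (\<forall>w\<in>C. cone_le C w x \<and> cone_le C w y \<longrightarrow> cone_le C w z)"
    using lat unfolding lattice_cone_def by simp_all
  have "lattice_cone D" unfolding lattice_cone_def
  proof (intro conjI ballI)
    show "convex_cone D"
      unfolding convex_cone_def convex_def conic_def
      using add scale D0 by blast
    have snd_nonneg: "snd p \<ge> 0 \<and> (snd p = 0 \<longrightarrow> p = 0)" if "p \<in> D" for p
      using Dcases[OF that] by auto
    have "p = 0" if "p \<in> D" "- p \<in> D" for p
      using snd_nonneg[OF that(1)] snd_nonneg[OF that(2)] by auto
    moreover have "0 \<in> uminus ` D" using D0 by (metis imageI minus_zero)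
    ultimately show "strict_cone D" unfolding strict_cone_def using D0 by auto
  next
    fix p q assume pq: "p \<in> D" "q \<in> D"
    obtain z where z: "z \<in> C" "cone_le C (h p) z" "cone_le C (h q) z"
      "\<And>w. w \<in> C \<Longrightarrow> cone_le C (h p) w \<Longrightarrow> cone_le C (h q) w \<Longrightarrow> cone_le C z w"
      using lat_sup[rule_format, OF hC[OF pq(1)] hC[OF pq(2)]] by blast
    obtain r where r: "r \<in> D" "h r = z" using surj z by blast
    show "\<exists>z\<in>D. cone_le D p z \<and> cone_le D q z \<and>
        (\<forall>w\<in>D. cone_le D p w \<and> cone_le D q w \<longrightarrow> cone_le D z w)"
      by (rule bexI[of _ r]) (use r z pq hC le in auto)
  next
    fix p q assume pq: "p \<in> D" "q \<in> D"
    obtain z where z: "z \<in> C" "cone_le C z (h p)" "cone_le C z (h q)"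
      "\<And>w. w \<in> C \<Longrightarrow> cone_le C w (h p) \<Longrightarrow> cone_le C w (h q) \<Longrightarrow> cone_le C w z"
      using lat_inf[rule_format, OF hC[OF pq(1)] hC[OF pq(2)]] by blast
    obtain r where r: "r \<in> D" "h r = z" using surj z by blast
    show "\<exists>z\<in>D. cone_le D z p \<and> cone_le D z q \<and>
        (\<forall>w\<in>D. cone_le D w p \<and> cone_le D w q \<longrightarrow> cone_le D w z)"
      by (rule bexI[of _ r]) (use r z pq hC le in auto)
  qed
  moreover have "base_of_cone D (K \<times> {1})"
    unfolding base_of_cone_def
  proof (intro conjI ballI)
    show "convex (K \<times> {1::real})" using K by (intro convex_Times) auto
    show "K \<times> {1} \<subseteq> D" using Dk[of 1] by auto
    fix p assume "p \<in> D - {0}"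
    then obtain a k where ak: "p = (a *\<^sub>R k, a)" "a > 0" "k \<in> K" using Dcases by blast
    then show "\<exists>!(\<alpha>, x). \<alpha> > 0 \<and> x \<in> K \<times> {1} \<and> p = \<alpha> *\<^sub>R x"
      by (intro ex1I[of _ "(a, (k, 1))"]) auto
  qed
  moreover have "affinely_isomorphic K (K \<times> {1::real})"
    unfolding affinely_isomorphic_def
    by (rule exI[of _ "\<lambda>x. (x, 1)"]) (auto simp: bij_betw_def inj_on_def)
  ultimately show ?thesis using K unfolding is_simplex_def by blast
qed

theorem is_simplexI:
  fixes K :: "'v::real_vector set" and C :: "'w::real_vector set"
  assumes K: "convex K" and lat: "lattice_cone C" and base: "base_of_cone C B"
    and iso: "affinely_isomorphic K B"
  shows "is_simplex K"
proof -
  obtain f where bij: "bij_betw f K B"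
    and aff: "\<And>x y t. x \<in> K \<Longrightarrow> y \<in> K \<Longrightarrow> 0 \<le> t \<Longrightarrow> t \<le> 1 \<Longrightarrow>
      f ((1 - t) *\<^sub>R x + t *\<^sub>R y) = (1 - t) *\<^sub>R f x + t *\<^sub>R f y"
    using iso unfolding affinely_isomorphic_def by auto
  show ?thesis
  proof (cases "0 \<in> B")
    case False
    show ?thesis by (rule is_simplexI_nonzero[OF K lat base bij False aff])
  next
    case True
    have "b = 0" if "b \<in> B" for b
    proof (rule ccontr)
      assume "b \<noteq> 0"
      have "convex B" "B \<subseteq> C" using base by (auto simp: base_of_cone_def)
      then have "(1 - 1/2) *\<^sub>R 0 + (1/2) *\<^sub>R b \<in> B"
        using True that by (intro convexD_alt) auto
      then have "(1/2) *\<^sub>R b \<in> B" by simp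
      then show False
        using base_of_cone_uniq[OF base, of 1 2 b "(1/2) *\<^sub>R b"] that \<open>b \<noteq> 0\<close> \<open>B \<subseteq> C\<close> by auto
    qed
    then have "B = {0}" using True by blast
    then obtain v where v: "K = {v}"
      using bij by (metis bij_betw_empty2 bij_betw_singletonI bij_betw_inv_into bij_betw_def image_insert image_empty)
    have "lattice_cone {0::real..}"
      unfolding lattice_cone_def
    proof (intro conjI ballI)
      show "convex_cone {0::real..}" by (auto simp: convex_cone_def conic_def)
      show "strict_cone {0::real..}" by (force simp: strict_cone_def)
      fix x y :: real assume "x \<in> {0..}" "y \<in> {0..}"
      then show "\<exists>z\<in>{0..}. cone_le {0..} x z \<and> cone_le {0..} y z \<and>
          (\<forall>w\<in>{0..}. cone_le {0..} x w \<and> cone_le {0..} y w \<longrightarrow> cone_le {0..} z w)"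
        by (intro bexI[of _ "max x y"]) (auto simp: cone_le_def)
      show "\<exists>z\<in>{0..}. cone_le {0..} z x \<and> cone_le {0..} z y \<and>
          (\<forall>w\<in>{0..}. cone_le {0..} w x \<and> cone_le {0..} w y \<longrightarrow> cone_le {0..} w z)"
        using \<open>x \<in> {0..}\<close> \<open>y \<in> {0..}\<close>
        by (intro bexI[of _ "min x y"]) (auto simp: cone_le_def)
    qed
    moreover have "base_of_cone {0::real..} {1}"
      unfolding base_of_cone_def
    proof (intro conjI ballI)
      fix y :: real assume "y \<in> {0..} - {0}"
      then show "\<exists>!(\<alpha>, x). \<alpha> > 0 \<and> x \<in> {1} \<and> y = \<alpha> *\<^sub>R x"
        by (intro ex1I[of _ "(y, 1)"]) auto
    qed auto
    ultimately show ?thesis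
      by (rule is_simplexI_nonzero[OF K, where f = "\<lambda>_. 1"]) (auto simp: v bij_betw_def)
  qed
qed

end

(* The partial addition makes M a cancellative partial commutative monoid with Riesz decomposition,
   all of whose elements lie below idempotents. By the Riesz decomposition the positive part
   x |-> sup {f y | y below x} of an additive function f is additive, so the positive additive
   functions that attain their maximum form a lattice cone, of which the state space is a base.

   If M has a top t, then states are the additive maps into [0,1] with value 1 at t, a closed
   condition. The extreme states are those that vanish at x or at y whenever x and y are disjoint,
   again a closed condition: the component of an extreme state s in the polar of y is a multiple
   of s; and conversely a state s with this property determines all states that vanish where s
   does, as n s(x) can be computed modulo 1 in M.

   If M has no top, then each idempotent a has a non-zero idempotent c disjoint from it, and a state
   living on [0,c] vanishes at a, so the increasing open cover {s | s a > 1/2} has no finite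
   subcover. A state on [0,c] is a minimal sublinear functional on the formal sums of
   elements, preordered by refinement. *)

theory Submission
  imports Defs "HOL-Library.Multiset"
begin

text \<open>The axioms do not say that the lattice order agrees with the orders of the MV-algebras
  [0,a]. It serves to bound elements by idempotents and to characterise \<open>lam\<close>;
  everything else is done with the algebraic order \<open>\<sqsubseteq>\<close> of the partial sum.
  There is no global negation either, so each computation takes place in [0,e] for an idempotent e
  above all elements at hand, and independence of e has to be proved.

  The refinement property is proved in a sharp form, with disjoint off-diagonal entries; the
  disjointness is what permits the computation modulo 1. Suprema are taken over an ideal J, so that
  one additivity lemma yields the lattice operations of the cone (J is everything), the component of
  a state in a polar (J is the polar), and the extension of a state from [0,c] to M (J is [0,c]).

  For the existence of states, formal sums supply the multiples that M lacks. The danger is that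
  their preorder collapses, with (n+1)c below nc; cancellation by common refinements excludes
  this.\<close>

section \<open>The MV-algebras below idempotents\<close>

context mv_algebra
begin

lemma unit_closed: "u \<in> A"
  using neg_closed unit_eq zero_closed by simp

lemma neg_unit: "neg u = z"
  using neg_neg unit_eq zero_closed by simp

lemma zero_add: "x \<in> A \<Longrightarrow> z \<boxplus> x = x"
  using add_comm add_zero zero_closed by simp

lemma unit_add: "x \<in> A \<Longrightarrow> u \<boxplus> x = u"
  using add_comm add_unit unit_closed by metis

lemma add_left_commute: "x \<in> A \<Longrightarrow> y \<in> A \<Longrightarrow> w \<in> A \<Longrightarrow> x \<boxplus> (y \<boxplus> w) = y \<boxplus> (x \<boxplus> w)"
  by (metis add_assoc add_comm)

lemmas add_simps = add_closed neg_closed zero_closed unit_closed neg_unit zero_add unit_add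
  add_zero add_unit neg_neg unit_eq[symmetric]

lemma neg_add_self: "x \<in> A \<Longrightarrow> neg x \<boxplus> x = u"
  using mv_axiom[of u x] by (simp add: add_simps)

text \<open>Both sides of the MV axiom at \<open>neg x\<close> and \<open>w\<close> are the join of
  these two. The last hypothesis says that \<open>w\<close> is below \<open>neg x\<close>, so the
  join is \<open>neg x\<close>.\<close>

lemma neg_add_cancel:
  assumes "x \<in> A" "w \<in> A" "neg x \<boxplus> neg w = u"
  shows "neg (w \<boxplus> x) \<boxplus> w = neg x"
proof -
  have "neg (neg (neg x) \<boxplus> w) \<boxplus> w = neg (neg w \<boxplus> neg x) \<boxplus> neg x"
    using assms by (intro mv_axiom) (auto simp: add_simps)
  moreover have "neg w \<boxplus> neg x = u"
    using assms by (simp add: add_comm neg_closed)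
  ultimately show ?thesis
    using assms by (simp add: add_simps add_comm)
qed

lemma orthogonal_cancel:
  assumes "x \<in> A" "y \<in> A" "w \<in> A" "neg x \<boxplus> neg w = u" "neg y \<boxplus> neg w = u" "x \<boxplus> w = y \<boxplus> w"
  shows "x = y"
  using neg_add_cancel[of x w] neg_add_cancel[of y w] assms
  by (metis add_comm neg_neg)

text \<open>By \<open>neg_add_cancel\<close>, the complement of each summand of
  \<open>x \<boxplus> y\<close> is \<open>neg (x \<boxplus> y)\<close> plus the other summand, and
  \<open>neg w\<close> is absorbed by the first of these terms.\<close>

lemma orthogonal_assoc:
  assumes "x \<in> A" "y \<in> A" "w \<in> A" "neg x \<boxplus> neg y = u" "neg (x \<boxplus> y) \<boxplus> neg w = u"
  shows "neg y \<boxplus> neg w = u" "neg x \<boxplus> neg (y \<boxplus> w) = u"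
proof -
  have "neg y = neg (x \<boxplus> y) \<boxplus> x"
    using neg_add_cancel[of y x] assms by (simp add: add_comm neg_closed)
  then have "neg y \<boxplus> neg w = x \<boxplus> (neg (x \<boxplus> y) \<boxplus> neg w)"
    using assms by (simp add: add_simps add_assoc add_comm add_left_commute)
  then show yw: "neg y \<boxplus> neg w = u"
    using assms by (simp add: add_simps)
  have "neg x = neg (x \<boxplus> y) \<boxplus> y"
    using neg_add_cancel[of x y] assms by (simp add: add_comm)
  then have "neg x \<boxplus> neg (y \<boxplus> w) = neg (x \<boxplus> y) \<boxplus> (neg (y \<boxplus> w) \<boxplus> y)"
    using assms by (simp add: add_simps add_assoc add_comm add_left_commute)
  also have "neg (y \<boxplus> w) \<boxplus> y = neg w"
    using neg_add_cancel[of w y] assms yw by (simp add: add_comm neg_closed)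
  finally show "neg x \<boxplus> neg (y \<boxplus> w) = u"
    using assms by simp
qed

lemma neg_add_unit_of_add:
  assumes "x \<in> A" "y \<in> A"
  shows "neg x \<boxplus> (x \<boxplus> y) = u"
  using assms by (simp add: add_assoc[symmetric] add_simps neg_add_self)

lemma add_eq_zero:
  assumes "x \<in> A" "y \<in> A" "x \<boxplus> y = z"
  shows "x = z"
proof -
  have "neg x = u"
    using neg_add_unit_of_add[of x y] assms by (simp add: add_simps)
  then show ?thesis using assms neg_neg neg_unit by metis
qed

lemma difference:
  assumes "x \<in> A" "t \<in> A" "neg x \<boxplus> t = u"
  defines "d \<equiv> neg (neg t \<boxplus> x)"
  shows "neg x \<boxplus> neg d = u" "x \<boxplus> d = t"
proof -
  have "neg x \<boxplus> neg d = neg t \<boxplus> (neg x \<boxplus> x)"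
    unfolding d_def using assms by (simp add: add_simps add_left_commute)
  then show "neg x \<boxplus> neg d = u" using assms by (simp add: add_simps neg_add_self)
  have "d \<boxplus> x = t"
    unfolding d_def using mv_axiom[of t x] assms by (simp add: add_simps)
  then show "x \<boxplus> d = t"
    unfolding d_def using assms by (simp add: add_simps add_comm)
qed

text \<open>\<open>b\<close> and \<open>c\<close> are what remains of \<open>x\<close> and
  \<open>p\<close> after subtracting their meet, and \<open>b \<boxplus> p = c \<boxplus> x\<close>
  is the join. By the last claim \<open>b\<close> is the least element that has to be added to
  \<open>p\<close> in order to reach \<open>x\<close>.\<close>

lemma meet_complement:
  assumes x: "x \<in> A" and p: "p \<in> A"
  defines "b \<equiv> neg (neg x \<boxplus> p)" and "c \<equiv> neg (neg p \<boxplus> x)"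
  shows "b \<in> A" "c \<in> A" "b \<boxplus> p = c \<boxplus> x" "neg b \<boxplus> neg p = u" "neg c \<boxplus> neg x = u"
    "neg b \<boxplus> x = u" "neg c \<boxplus> p = u"
    "\<And>v. v \<in> A \<Longrightarrow> neg x \<boxplus> (p \<boxplus> v) = u \<Longrightarrow> neg b \<boxplus> v = u"
proof -
  show bc: "b \<in> A" "c \<in> A" using x p by (auto simp: b_def c_def add_simps)
  show "b \<boxplus> p = c \<boxplus> x" unfolding b_def c_def by (rule mv_axiom[OF x p])
  have nb: "neg b = neg x \<boxplus> p" and nc: "neg c = neg p \<boxplus> x"
    using x p by (auto simp: b_def c_def add_simps)
  have self: "w \<boxplus> neg w = u" if "w \<in> A" for w
    using that neg_add_self add_comm by (simp add: neg_closed)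
  show "neg b \<boxplus> neg p = u" "neg c \<boxplus> neg x = u"
    using x p by (simp_all add: nb nc add_assoc add_simps self)
  show "neg b \<boxplus> x = u" "neg c \<boxplus> p = u"
    using x p neg_add_unit_of_add add_comm by (metis nb nc add_assoc neg_closed)+
  show "neg b \<boxplus> v = u" if "v \<in> A" "neg x \<boxplus> (p \<boxplus> v) = u" for v
    using x p that by (simp add: nb add_assoc add_simps)
qed

end

section \<open>Independence of the ambient idempotent\<close>

lemma idempotent_bound2:
  fixes x y :: "'a::emv_algebra"
  obtains e where "idempotent e" "x \<le> e" "y \<le> e"
  using below_idempotent[of "sup x y"] by auto

lemma idempotent_bound3:
  fixes x y z :: "'a::emv_algebra"
  obtains e where "idempotent e" "x \<le> e" "y \<le> e" "z \<le> e"
  using below_idempotent[of "sup x (sup y z)"] by auto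

lemma oplus_closed_interval:
  fixes e :: "'a::emv_algebra"
  assumes "idempotent e" "x \<le> e" "y \<le> e"
  shows "x \<oplus> y \<le> e"
proof -
  interpret mv_algebra "{0..e}" "(\<oplus>)" "lam e" 0 e by (rule mv_interval[OF assms(1)])
  show ?thesis using add_closed[of x y] assms by (simp add: zero_least)
qed

lemma idempotent_absorb:
  fixes e :: "'a::emv_algebra"
  assumes "idempotent e" "x \<le> e"
  shows "x \<oplus> e = e"
proof -
  interpret mv_algebra "{0..e}" "(\<oplus>)" "lam e" 0 e by (rule mv_interval[OF assms(1)])
  show ?thesis using add_unit[of x] assms by (simp add: zero_least)
qed

lemma lam_bound:
  fixes e :: "'a::emv_algebra"
  assumes "idempotent e" "x \<le> e"
  shows "lam e x \<le> e"
proof -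
  interpret mv_algebra "{0..e}" "(\<oplus>)" "lam e" 0 e by (rule mv_interval[OF assms(1)])
  show ?thesis using neg_closed[of x] assms by (simp add: zero_least)
qed

lemma lam_least:
  fixes e :: "'a::emv_algebra"
  assumes "idempotent e" "x \<le> e" "w \<le> e" "w \<oplus> x = e"
  shows "lam e x \<le> w"
  unfolding lam_def
proof (rule Least1_le)
  show "\<exists>!z. (z \<in> {0..e} \<and> z \<oplus> x = e) \<and> (\<forall>y. y \<in> {0..e} \<and> y \<oplus> x = e \<longrightarrow> z \<le> y)"
    using lam_exists[OF assms(1), of x] assms(2) by (auto simp: zero_least intro!: antisym)
  show "w \<in> {0..e} \<and> w \<oplus> x = e" using assms by (simp add: zero_least)
qed

text \<open>The order of the MV-algebra \<open>[0,e]\<close> is contained in the given lattice order. The converse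
  is not among the axioms.\<close>

lemma le_if_lam_oplus:
  fixes e :: "'a::emv_algebra"
  assumes "idempotent e" "x \<le> e" "y \<le> e" "lam e x \<oplus> y = e"
  shows "x \<le> y"
proof -
  interpret mv_algebra "{0..e}" "(\<oplus>)" "lam e" 0 e by (rule mv_interval[OF assms(1)])
  have "lam e (lam e x) \<le> y"
    using assms(4) by (intro lam_least[OF assms(1) lam_bound[OF assms(1,2)] assms(3)]) (simp add: oplus_commute)
  then show ?thesis using neg_neg[of x] assms by (simp add: zero_least)
qed

text \<open>The right-hand side is the difference a - x computed in [0,d]. It competes for the
  minimum that defines \<open>lam a x\<close>; conversely it lies below \<open>lam a x\<close> in
  the order of [0,d], hence in the lattice order, where the two estimates meet.\<close>

lemma lam_restrict:
  fixes d :: "'a::emv_algebra"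
  assumes a: "idempotent a" "x \<le> a" and d: "idempotent d" "a \<le> d"
  shows "lam a x = lam d (lam d a \<oplus> x)"
proof -
  interpret D: mv_algebra "{0..d}" "(\<oplus>)" "lam d" 0 d by (rule mv_interval[OF d(1)])
  interpret A: mv_algebra "{0..a}" "(\<oplus>)" "lam a" 0 a by (rule mv_interval[OF a(1)])
  have in_d: "x \<in> {0..d}" "a \<in> {0..d}" using assms by (auto simp: zero_least)
  have in_a: "x \<in> {0..a}" using assms by (auto simp: zero_least)
  define w where "w = lam d (lam d a \<oplus> x)"
  have w: "w \<in> {0..d}" unfolding w_def by (intro D.add_simps in_d)
  have xa: "lam d x \<oplus> a = d"
    using D.neg_add_unit_of_add[OF in_d] idempotent_absorb[OF a] by simp
  note diff = D.difference[OF in_d xa, folded w_def]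
  \<comment> \<open>Membership of \<open>w\<close> in [0,a] is part of the condition in the
    minimum.\<close>
  have w_below: "lam d w \<oplus> a = d"
    using D.neg_add_unit_of_add[OF w in_d(1)] diff(2) by (simp add: oplus_commute)
  have wa: "w \<le> a"
    using le_if_lam_oplus[OF d(1) _ d(2) w_below] w by simp
  have "lam a x \<le> w"
    using lam_least[OF a wa] diff(2) by (simp add: oplus_commute)
  moreover have "w \<le> lam a x"
  proof (rule le_if_lam_oplus[OF d(1)])
    show "lam a x \<le> d" using lam_bound[OF a] d(2) by simp
    have "lam d w = lam d a \<oplus> x"
      unfolding w_def by (rule D.neg_neg) (intro D.add_simps in_d)
    then have "lam d w \<oplus> lam a x = lam d a \<oplus> (lam a x \<oplus> x)"
      by (simp add: oplus_assoc oplus_commute[of x])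
    then show "lam d w \<oplus> lam a x = d"
      using A.neg_add_self[OF in_a] D.neg_add_self[OF in_d(2)] by simp
  qed (use w in auto)
  ultimately show ?thesis unfolding w_def by (rule antisym)
qed

lemma odot_eq_zero_iff:
  fixes a :: "'a::emv_algebra"
  assumes "idempotent a" "x \<le> a" "y \<le> a"
  shows "odot a x y = 0 \<longleftrightarrow> lam a x \<oplus> lam a y = a"
proof -
  interpret mv_algebra "{0..a}" "(\<oplus>)" "lam a" 0 a by (rule mv_interval[OF assms(1)])
  have "lam a x \<oplus> lam a y \<in> {0..a}"
    using assms by (intro add_simps) (auto simp: zero_least)
  then show ?thesis unfolding odot_def using neg_neg neg_unit unit_eq by metis
qed

text \<open>With this, summability may be tested in any interval that contains both elements, and
  later proofs are free to enlarge the idempotent.\<close>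

lemma lam_sum_restrict:
  fixes d :: "'a::emv_algebra"
  assumes a: "idempotent a" "x \<le> a" "y \<le> a" and d: "idempotent d" "a \<le> d"
  shows "lam a x \<oplus> lam a y = a \<longleftrightarrow> lam d x \<oplus> lam d y = d"
proof -
  interpret D: mv_algebra "{0..d}" "(\<oplus>)" "lam d" 0 d by (rule mv_interval[OF d(1)])
  have in_d: "x \<in> {0..d}" "y \<in> {0..d}" "a \<in> {0..d}" using assms by (auto simp: zero_least)
  have diff: "lam d v \<oplus> lam d (lam a v) = d" "v \<oplus> lam a v = a"
    if "v \<le> a" for v
  proof -
    have v: "v \<in> {0..d}" using that d by (auto simp: zero_least)
    have "lam d v \<oplus> a = d"
      using D.neg_add_unit_of_add[OF v in_d(3)] idempotent_absorb[OF a(1) that] by simp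
    then show "lam d v \<oplus> lam d (lam a v) = d" "v \<oplus> lam a v = a"
      using D.difference[OF v in_d(3)] lam_restrict[OF a(1) that d] by auto
  qed
  have lam_in: "lam a v \<in> {0..d}" if "v \<le> a" for v
    using lam_bound[OF a(1) that] d(2) by (auto simp: zero_least)
  show ?thesis
  proof
    assume eq: "lam a x \<oplus> lam a y = a"
    \<comment> \<open>The complement of v in [0,d] is made up of the part above a and the part
      between v and a.\<close>
    have neg: "lam d v = lam d a \<oplus> lam a v" if "v \<le> a" for v
    proof -
      have v: "v \<in> {0..d}" using that d by (auto simp: zero_least)
      show ?thesis
        using D.neg_add_cancel[OF v lam_in[OF that]] diff[OF that] by (simp add: oplus_commute)
    qed
    have "lam d x \<oplus> lam d y = lam d a \<oplus> (lam d a \<oplus> (lam a x \<oplus> lam a y))"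
      unfolding neg[OF a(2)] neg[OF a(3)] by (metis oplus_assoc oplus_commute)
    then show "lam d x \<oplus> lam d y = d"
      using eq D.neg_add_self[OF in_d(3)] D.add_unit[of "lam d a"] D.neg_closed[OF in_d(3)]
      by simp
  next
    assume eq: "lam d x \<oplus> lam d y = d"
    have xy: "x \<oplus> y \<le> a" by (rule oplus_closed_interval[OF a])
    have xy_d: "x \<oplus> y \<in> {0..d}" using xy d by (auto simp: zero_least)
    \<comment> \<open>As x, y and \<open>w\<close> add up to a without overflow in [0,d], the
      complement of x in [0,a] has to be \<open>y \<oplus> w\<close>.\<close>
    define w where "w = lam a (x \<oplus> y)"
    have w: "w \<in> {0..d}" "w \<le> a"
      unfolding w_def using lam_in[OF xy] lam_bound[OF a(1) xy] by auto
    note assoc = D.orthogonal_assoc[OF in_d(1,2) w(1) eq diff(1)[OF xy, folded w_def]]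
    have "lam a x = y \<oplus> w"
    proof (rule D.orthogonal_cancel[OF _ _ in_d(1)])
      show "lam a x \<in> {0..d}" by (rule lam_in[OF a(2)])
      show "y \<oplus> w \<in> {0..d}" by (intro D.add_simps in_d w)
      show "lam d (lam a x) \<oplus> lam d x = d" using diff(1)[OF a(2)] by (simp add: oplus_commute)
      show "lam d (y \<oplus> w) \<oplus> lam d x = d" using assoc(2) by (simp add: oplus_commute)
      show "lam a x \<oplus> x = y \<oplus> w \<oplus> x"
        using diff(2)[OF a(2)] diff(2)[OF xy, folded w_def] by (metis oplus_assoc oplus_commute)
    qed
    then have "lam a x \<oplus> lam a y = w \<oplus> a"
      using diff(2)[OF a(3)] by (metis oplus_assoc oplus_commute)
    then show "lam a x \<oplus> lam a y = a" using idempotent_absorb[OF a(1) w(2)] by simp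
  qed
qed

lemma summable_pair_iff:
  fixes d :: "'a::emv_algebra"
  assumes "idempotent d" "x \<le> d" "y \<le> d"
  shows "summable_pair x y \<longleftrightarrow> lam d x \<oplus> lam d y = d"
proof
  assume "summable_pair x y"
  then obtain a where a: "idempotent a" "x \<le> a" "y \<le> a" "lam a x \<oplus> lam a y = a"
    unfolding summable_pair_def using odot_eq_zero_iff by blast
  obtain e where e: "idempotent e" "a \<le> e" "d \<le> e" by (rule idempotent_bound2)
  have "lam e x \<oplus> lam e y = e" using lam_sum_restrict[OF a(1-3) e(1,2)] a(4) by simp
  then show "lam d x \<oplus> lam d y = d" using lam_sum_restrict[OF assms e(1,3)] by simp
next
  assume "lam d x \<oplus> lam d y = d"
  then show "summable_pair x y"
    unfolding summable_pair_def using odot_eq_zero_iff assms by blast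
qed

section \<open>The partial addition\<close>

text \<open>States are monotone for this order by additivity. It is contained in
  \<open>\<le>\<close> and agrees with it below an idempotent (\<open>sum_le_idempotent\<close>),
  which is how bounds in the lattice order are brought in.\<close>

definition sum_le :: "'a::emv_algebra \<Rightarrow> 'a \<Rightarrow> bool" (infix "\<sqsubseteq>" 50)
  where "x \<sqsubseteq> y \<longleftrightarrow> (\<exists>z. summable_pair x z \<and> x \<oplus> z = y)"

lemma summable_pair_commute: "summable_pair x y \<longleftrightarrow> summable_pair y x"
  for x y :: "'a::emv_algebra"
proof -
  obtain e where "idempotent e" "x \<le> e" "y \<le> e" by (rule idempotent_bound2)
  then show ?thesis by (simp add: summable_pair_iff oplus_commute)
qed

lemma summable_pair_zero [simp]: "summable_pair x 0" "summable_pair 0 x"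
  for x :: "'a::emv_algebra"
proof -
  obtain e where e: "idempotent e" "x \<le> e" using below_idempotent by blast
  interpret mv_algebra "{0..e}" "(\<oplus>)" "lam e" 0 e by (rule mv_interval[OF e(1)])
  have "lam e x \<oplus> lam e 0 = e"
    using e unit_eq add_unit[of "lam e x"] neg_closed[of x] by (simp add: zero_least)
  then show "summable_pair x 0" using e by (simp add: summable_pair_iff zero_least)
  then show "summable_pair 0 x" by (simp add: summable_pair_commute)
qed

lemma oplus_0 [simp]: "x \<oplus> 0 = x" "0 \<oplus> x = x" for x :: "'a::emv_algebra"
  using oplus_zero oplus_commute by metis+

lemma summable_pair_assoc:
  fixes x y w :: "'a::emv_algebra"
  assumes "summable_pair x y" "summable_pair (x \<oplus> y) w"
  shows "summable_pair y w" "summable_pair x (y \<oplus> w)"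
proof -
  obtain e where e: "idempotent e" "x \<le> e" "y \<le> e" "w \<le> e" by (rule idempotent_bound3)
  interpret mv_algebra "{0..e}" "(\<oplus>)" "lam e" 0 e by (rule mv_interval[OF e(1)])
  show "summable_pair y w" "summable_pair x (y \<oplus> w)"
    using orthogonal_assoc[of x y w] assms e
    by (auto simp: summable_pair_iff[OF e(1)] oplus_closed_interval zero_least)
qed

lemma summable_pair_assoc':
  fixes x y w :: "'a::emv_algebra"
  assumes "summable_pair y w" "summable_pair x (y \<oplus> w)"
  shows "summable_pair x y" "summable_pair (x \<oplus> y) w"
  using summable_pair_assoc[of w y x] assms by (simp_all add: summable_pair_commute oplus_commute)

lemma oplus_left_commute: "x \<oplus> (y \<oplus> w) = y \<oplus> (x \<oplus> w)" for x y w :: "'a::emv_algebra"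
  by (metis oplus_assoc oplus_commute)

lemmas oplus_ac = oplus_assoc oplus_commute oplus_left_commute

lemma summable_pair_cancel:
  fixes x y w :: "'a::emv_algebra"
  assumes "summable_pair x w" "summable_pair y w" "x \<oplus> w = y \<oplus> w"
  shows "x = y"
proof -
  obtain e where e: "idempotent e" "x \<le> e" "y \<le> e" "w \<le> e" by (rule idempotent_bound3)
  interpret mv_algebra "{0..e}" "(\<oplus>)" "lam e" 0 e by (rule mv_interval[OF e(1)])
  show ?thesis
    using orthogonal_cancel[of x y w] assms e
    by (auto simp: summable_pair_iff[OF e(1)] zero_least)
qed

lemma oplus_eq_zero:
  fixes x y :: "'a::emv_algebra"
  assumes "x \<oplus> y = 0"
  shows "x = 0" "y = 0"
proof -
  obtain e where e: "idempotent e" "x \<le> e" "y \<le> e" by (rule idempotent_bound2)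
  interpret mv_algebra "{0..e}" "(\<oplus>)" "lam e" 0 e by (rule mv_interval[OF e(1)])
  show "x = 0" "y = 0"
    using add_eq_zero[of x y] add_eq_zero[of y x] assms e
    by (auto simp: zero_least oplus_commute)
qed

lemma sum_le_iff_lam:
  fixes x y :: "'a::emv_algebra"
  assumes "idempotent e" "x \<le> e" "y \<le> e"
  shows "x \<sqsubseteq> y \<longleftrightarrow> lam e x \<oplus> y = e"
proof
  assume "x \<sqsubseteq> y"
  then obtain w where w: "x \<oplus> w = y" unfolding sum_le_def by blast
  obtain d where d: "idempotent d" "e \<le> d" "w \<le> d" by (rule idempotent_bound2)
  interpret D: mv_algebra "{0..d}" "(\<oplus>)" "lam d" 0 d by (rule mv_interval[OF d(1)])
  interpret E: mv_algebra "{0..e}" "(\<oplus>)" "lam e" 0 e by (rule mv_interval[OF assms(1)])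
  have le: "x \<le> d" "y \<le> d" using assms d by auto
  \<comment> \<open>The summand \<open>w\<close> comes without a bound by e, so it is first compared
    with y in the larger interval [0,d].\<close>
  have "w \<le> y"
    using le_if_lam_oplus[OF d(1) d(3) le(2)] D.neg_add_unit_of_add[of w x] w d le
    by (simp add: zero_least oplus_commute)
  then have "w \<le> e" using assms by simp
  then show "lam e x \<oplus> y = e"
    using E.neg_add_unit_of_add[of x w] w assms by (simp add: zero_least)
next
  interpret E: mv_algebra "{0..e}" "(\<oplus>)" "lam e" 0 e by (rule mv_interval[OF assms(1)])
  assume "lam e x \<oplus> y = e"
  note diff = E.difference[OF _ _ this]
  have "lam e (lam e y \<oplus> x) \<le> e"
    using assms by (intro lam_bound oplus_closed_interval) auto
  then show "x \<sqsubseteq> y"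
    unfolding sum_le_def using diff assms summable_pair_iff[OF assms(1,2)]
    by (auto simp: zero_least)
qed

lemma sum_le_imp_le: "x \<sqsubseteq> y \<Longrightarrow> x \<le> y"
  using idempotent_bound2[of x y] sum_le_iff_lam le_if_lam_oplus by metis

lemma sum_le_idempotent:
  fixes e :: "'a::emv_algebra"
  assumes "idempotent e"
  shows "x \<sqsubseteq> e \<longleftrightarrow> x \<le> e"
proof
  assume "x \<le> e"
  interpret E: mv_algebra "{0..e}" "(\<oplus>)" "lam e" 0 e by (rule mv_interval[OF assms(1)])
  show "x \<sqsubseteq> e" using sum_le_iff_lam[OF assms \<open>x \<le> e\<close>] E.add_unit E.neg_closed \<open>x \<le> e\<close>
    by (auto simp: zero_least)
qed (rule sum_le_imp_le)

lemma sum_le_refl [simp]: "x \<sqsubseteq> x"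
  unfolding sum_le_def by (rule exI[of _ 0]) simp

lemma zero_sum_le [simp]: "0 \<sqsubseteq> x"
  unfolding sum_le_def by simp

lemma sum_le_oplus: "summable_pair x y \<Longrightarrow> x \<sqsubseteq> x \<oplus> y" "summable_pair x y \<Longrightarrow> y \<sqsubseteq> x \<oplus> y"
  unfolding sum_le_def using summable_pair_commute oplus_commute by blast+

lemma sum_le_trans: "x \<sqsubseteq> y \<Longrightarrow> y \<sqsubseteq> w \<Longrightarrow> x \<sqsubseteq> w"
  unfolding sum_le_def by (metis oplus_assoc summable_pair_assoc(2))

lemma sum_le_zero: "x \<sqsubseteq> 0 \<Longrightarrow> x = 0"
  unfolding sum_le_def using oplus_eq_zero by blast

lemma summable_pair_mono:
  assumes "summable_pair x y" "x' \<sqsubseteq> x" "y' \<sqsubseteq> y"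
  shows "summable_pair x' y'"
proof -
  have "summable_pair x y'" if "summable_pair x y" "y' \<sqsubseteq> y" for x y y' :: 'a
    using that summable_pair_assoc'(1) unfolding sum_le_def by metis
  then show ?thesis using assms summable_pair_commute by blast
qed

lemma oplus_sum_le_mono:
  assumes "summable_pair x y" "x' \<sqsubseteq> x" "y' \<sqsubseteq> y"
  shows "x' \<oplus> y' \<sqsubseteq> x \<oplus> y"
proof -
  have "x \<oplus> y' \<sqsubseteq> x \<oplus> y" if xy: "summable_pair x y" "y' \<sqsubseteq> y" for x y y' :: 'a
  proof -
    obtain w where w: "summable_pair y' w" "y' \<oplus> w = y" using xy(2) unfolding sum_le_def by blast
    then have "summable_pair (x \<oplus> y') w" using xy(1) summable_pair_assoc'(2) by blast
    from sum_le_oplus(1)[OF this] show ?thesis using w(2) by (simp add: oplus_assoc)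
  qed
  from this[OF assms(1,3)] this[of y' x x'] show ?thesis
    using assms sum_le_trans summable_pair_commute oplus_commute summable_pair_mono sum_le_refl by metis
qed

text \<open>\<open>a\<close> is the meet of x and p in an interval, \<open>b\<close> and
  \<open>c\<close> are the remainders. They are disjoint because b is the least v with
  \<open>x \<sqsubseteq> p \<oplus> v\<close>: a common part w of b and c can be removed from b
  without losing this property, as p already supplies it through c, and then w vanishes by
  cancellation.\<close>

lemma disjoint_decomposition:
  fixes x p :: "'a::emv_algebra"
  obtains a b c where "summable_pair a b" "x = a \<oplus> b" "summable_pair a c" "p = a \<oplus> c"
    "\<forall>v. summable_pair p v \<longrightarrow> x \<sqsubseteq> p \<oplus> v \<longrightarrow> b \<sqsubseteq> v"
    "\<forall>w. w \<sqsubseteq> b \<longrightarrow> w \<sqsubseteq> c \<longrightarrow> w = 0"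
proof -
  obtain e where e: "idempotent e" "x \<le> e" "p \<le> e" by (rule idempotent_bound2)
  interpret mv_algebra "{0..e}" "(\<oplus>)" "lam e" 0 e by (rule mv_interval[OF e(1)])
  have in_e: "x \<in> {0..e}" "p \<in> {0..e}" using e by (auto simp: zero_least)
  define b where "b = lam e (lam e x \<oplus> p)"
  define c where "c = lam e (lam e p \<oplus> x)"
  note mc = meet_complement[OF in_e, folded b_def c_def]
  have be: "b \<le> e" and ce: "c \<le> e" using mc(1,2) by auto
  have bp: "summable_pair b p" and cx: "summable_pair c x" and bx: "b \<sqsubseteq> x"
    using mc be ce e by (simp_all add: summable_pair_iff sum_le_iff_lam)
  have b_le: "b \<sqsubseteq> v" if v: "summable_pair p v" "x \<sqsubseteq> p \<oplus> v" for v
  proof -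
    obtain d where d: "idempotent d" "e \<le> d" "v \<le> d" by (rule idempotent_bound2)
    interpret D: mv_algebra "{0..d}" "(\<oplus>)" "lam d" 0 d by (rule mv_interval[OF d(1)])
    have in_d: "x \<in> {0..d}" "p \<in> {0..d}" using e d by (auto simp: zero_least)
    \<comment> \<open>\<open>v\<close> may lie outside [0,e]. The same difference formed in [0,d] is
      below \<open>v\<close> by its minimality there; it also lies in [0,e], so the minimality of
      \<open>b\<close> applies to it.\<close>
    define b' where "b' = lam d (lam d x \<oplus> p)"
    note mc' = D.meet_complement[OF in_d, folded b'_def]
    have b'd: "b' \<le> d" using mc'(1) by simp
    have "lam d x \<oplus> (p \<oplus> v) = d"
      using sum_le_iff_lam[OF d(1), of x "p \<oplus> v"] v(2) in_d d oplus_closed_interval[OF d(1), of p v] by simp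
    then have "lam d b' \<oplus> v = d" using d by (intro mc'(8)) (auto simp: zero_least)
    then have b'v: "b' \<sqsubseteq> v" using sum_le_iff_lam[OF d(1) b'd d(3)] by simp
    have "b' \<sqsubseteq> x" using mc'(6) sum_le_iff_lam[OF d(1) b'd, of x] in_d by simp
    then have "b' \<le> e" using sum_le_imp_le e by force
    have "summable_pair b' p"
      using mc'(4) summable_pair_iff[OF d(1) b'd, of p] in_d by simp
    obtain w where w: "summable_pair p w" "x \<sqsubseteq> p \<oplus> w" "w = b'"
    proof
      show "summable_pair p b'" using \<open>summable_pair b' p\<close> summable_pair_commute by blast
      have "lam d (lam d p \<oplus> x) \<oplus> x = b' \<oplus> p" using mc'(3) by simp
      moreover have "summable_pair (lam d (lam d p \<oplus> x)) x"
        using mc'(2,5) in_d by (simp add: summable_pair_iff[OF d(1)])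
      ultimately show "x \<sqsubseteq> p \<oplus> b'"
        using sum_le_oplus(2) oplus_commute by metis
    qed simp
    have "lam e x \<oplus> (p \<oplus> b') = e"
      using sum_le_iff_lam[OF e(1,2), of "p \<oplus> b'"] w oplus_closed_interval[OF e(1,3) \<open>b' \<le> e\<close>] by simp
    then have "lam e b \<oplus> b' = e" using \<open>b' \<le> e\<close> by (intro mc(8)) (auto simp: zero_least)
    then have "b \<sqsubseteq> b'" using sum_le_iff_lam[OF e(1) be \<open>b' \<le> e\<close>] by simp
    then show "b \<sqsubseteq> v" using b'v sum_le_trans by blast
  qed
  obtain a where a: "summable_pair b a" "b \<oplus> a = x" using bx unfolding sum_le_def by blast
  have "summable_pair c (b \<oplus> a)" using cx a by simp
  then have ca: "summable_pair a c" "summable_pair b (a \<oplus> c)"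
    using summable_pair_assoc[OF a(1), of c] by (simp_all add: summable_pair_commute)
  have "p = a \<oplus> c"
  proof (rule summable_pair_cancel)
    show "summable_pair p b" "summable_pair (a \<oplus> c) b"
      using bp ca by (simp_all add: summable_pair_commute)
    show "p \<oplus> b = a \<oplus> c \<oplus> b" using mc(3) a(2) by (metis oplus_ac)
  qed
  moreover have "w = 0" if w: "w \<sqsubseteq> b" "w \<sqsubseteq> c" for w
  proof -
    obtain b' where b': "summable_pair w b'" "w \<oplus> b' = b" using w(1) unfolding sum_le_def by blast
    have paw: "summable_pair a w" "summable_pair (a \<oplus> w) b'"
      using summable_pair_assoc'[OF b'(1), of a] a(1) b'(2) by (simp_all add: summable_pair_commute)
    obtain c' where c': "summable_pair w c'" "w \<oplus> c' = c" using w(2) unfolding sum_le_def by blast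
    have pc: "summable_pair (a \<oplus> w) c'"
      using summable_pair_assoc'[OF c'(1), of a] ca(1) c'(2) by simp
    have bp': "summable_pair b' p"
      using summable_pair_mono[OF bp _ sum_le_refl] b' sum_le_oplus(2) by blast
    have "p \<oplus> b' = x \<oplus> c'"
      using \<open>p = a \<oplus> c\<close> a(2) b'(2) c'(2) by (metis oplus_ac)
    moreover have "summable_pair x c'"
      using summable_pair_mono[OF cx] c' sum_le_oplus(2) summable_pair_commute sum_le_refl by blast
    ultimately have "x \<sqsubseteq> p \<oplus> b'" using sum_le_oplus(1) by metis
    then have "b \<sqsubseteq> b'" using b_le bp' summable_pair_commute by blast
    then obtain r where r: "summable_pair b r" "b' = b \<oplus> r"
      unfolding sum_le_def by metis
    have "(w \<oplus> r) \<oplus> b' = 0 \<oplus> b'" using r b' by (metis oplus_ac oplus_0)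
    moreover have "summable_pair (w \<oplus> r) b'"
    proof -
      have "summable_pair r (b' \<oplus> w)" using r(1) b' by (simp add: summable_pair_commute oplus_commute)
      then show ?thesis using summable_pair_assoc'[of b' w r] b'(1)
        by (metis oplus_commute summable_pair_assoc'(2) summable_pair_commute)
    qed
    ultimately have "w \<oplus> r = 0" using summable_pair_cancel[of "w \<oplus> r" b' 0] by simp
    then show "w = 0" using oplus_eq_zero by blast
  qed
  ultimately show ?thesis
    using that[of a b c] a ca(1) b_le by (simp add: summable_pair_commute oplus_commute)
qed

text \<open>A table with row sums x, y and column sums p, q. The first row and column come from
  \<open>disjoint_decomposition\<close>; minimality of b against q gives
  \<open>b \<sqsubseteq> q\<close>, d is the rest of q, and the second row follows by cancelling
  x.\<close>

lemma disjoint_refinement: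
  fixes x y p q :: "'a::emv_algebra"
  assumes xy: "summable_pair x y" and pq: "summable_pair p q" and eq: "x \<oplus> y = p \<oplus> q"
  obtains a b c d where "summable_pair a b" "x = a \<oplus> b" "summable_pair c d" "y = c \<oplus> d"
    "summable_pair a c" "p = a \<oplus> c" "summable_pair b d" "q = b \<oplus> d"
    "\<forall>w. w \<sqsubseteq> b \<longrightarrow> w \<sqsubseteq> c \<longrightarrow> w = 0"
proof -
  obtain a b c where abc: "summable_pair a b" "x = a \<oplus> b" "summable_pair a c" "p = a \<oplus> c"
    "\<forall>v. summable_pair p v \<longrightarrow> x \<sqsubseteq> p \<oplus> v \<longrightarrow> b \<sqsubseteq> v"
    "\<forall>w. w \<sqsubseteq> b \<longrightarrow> w \<sqsubseteq> c \<longrightarrow> w = 0"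
    by (rule disjoint_decomposition)
  have "b \<sqsubseteq> q" using abc(5) pq sum_le_oplus(1)[OF xy] eq by simp
  then obtain d where d: "summable_pair b d" "q = b \<oplus> d" unfolding sum_le_def by blast
  have "summable_pair (a \<oplus> c) (b \<oplus> d)" using pq abc d by simp
  then have acd: "summable_pair c (b \<oplus> d)" "summable_pair a (c \<oplus> (b \<oplus> d))"
    using summable_pair_assoc[OF abc(3)] by blast+
  then have cd: "summable_pair c d" "summable_pair (c \<oplus> d) b"
    using summable_pair_assoc'[of d b c] d(1) by (simp_all add: summable_pair_commute oplus_commute)
  have "summable_pair a (b \<oplus> (c \<oplus> d))" using acd(2) by (simp add: oplus_ac)
  then have "summable_pair (a \<oplus> b) (c \<oplus> d)"
    using summable_pair_assoc'(2)[of b "c \<oplus> d" a] cd(2) summable_pair_commute by blast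
  then have "summable_pair (c \<oplus> d) x" unfolding abc(2) using summable_pair_commute by blast
  moreover have "y \<oplus> x = (c \<oplus> d) \<oplus> x"
    using eq abc d by (metis oplus_ac)
  ultimately have "y = c \<oplus> d"
    using xy summable_pair_cancel[of y x "c \<oplus> d"] summable_pair_commute by blast
  then show ?thesis using that abc(1-4,6) cd(1) d by blast
qed

section \<open>The cone of additive functions\<close>

definition additive_on :: "'a::emv_algebra set \<Rightarrow> ('a \<Rightarrow> real) \<Rightarrow> bool"
  where "additive_on J f \<longleftrightarrow>
    (\<forall>x\<in>J. \<forall>y\<in>J. summable_pair x y \<longrightarrow> f (x \<oplus> y) = f x + f y)"

definition sum_ideal :: "'a::emv_algebra set \<Rightarrow> bool"
  where "sum_ideal J \<longleftrightarrow> 0 \<in> J \<and> (\<forall>x y. x \<in> J \<longrightarrow> y \<sqsubseteq> x \<longrightarrow> y \<in> J) \<and>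
    (\<forall>x\<in>J. \<forall>y\<in>J. summable_pair x y \<longrightarrow> x \<oplus> y \<in> J)"

text \<open>For a non-negative f on a proper ideal J this is the least positive additive extension
  of f to M, whatever the values of f outside J are.\<close>

definition positive_part_on :: "'a::emv_algebra set \<Rightarrow> ('a \<Rightarrow> real) \<Rightarrow> 'a \<Rightarrow> real"
  where "positive_part_on J f x = Sup (f ` {y \<in> J. y \<sqsubseteq> x})"

lemma additive_onD:
  "additive_on J f \<Longrightarrow> x \<in> J \<Longrightarrow> y \<in> J \<Longrightarrow> summable_pair x y \<Longrightarrow> f (x \<oplus> y) = f x + f y"
  unfolding additive_on_def by blast

lemma additive_on_zero:
  assumes "additive_on J f" "0 \<in> J"
  shows "f 0 = 0"
  using additive_onD[OF assms(1), of 0 0] assms(2) by simp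

lemma additive_on_mono:
  assumes "additive_on J f" "\<And>x. x \<in> J \<Longrightarrow> 0 \<le> f x" "sum_ideal J" "y \<in> J" "x \<sqsubseteq> y"
  shows "f x \<le> f y"
proof -
  obtain w where w: "summable_pair x w" "y = x \<oplus> w" using assms(5) unfolding sum_le_def by blast
  then have "x \<in> J" "w \<in> J" using assms(3,4) sum_le_oplus unfolding sum_ideal_def by blast+
  then show ?thesis using additive_onD[OF assms(1) _ _ w(1)] assms(2) w(2) by simp
qed

lemma sum_ideal_UNIV [simp]: "sum_ideal UNIV"
  by (simp add: sum_ideal_def)

context
  fixes J :: "'a::emv_algebra set" and f :: "'a \<Rightarrow> real"
  assumes ideal: "sum_ideal J" and add: "additive_on J f"
    and bdd: "\<And>x. bdd_above (f ` {y \<in> J. y \<sqsubseteq> x})"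
begin

lemma positive_part_upper: "y \<in> J \<Longrightarrow> y \<sqsubseteq> x \<Longrightarrow> f y \<le> positive_part_on J f x"
  unfolding positive_part_on_def by (intro cSup_upper bdd) auto

lemma positive_part_least:
  assumes "\<And>y. y \<in> J \<Longrightarrow> y \<sqsubseteq> x \<Longrightarrow> f y \<le> B"
  shows "positive_part_on J f x \<le> B"
  unfolding positive_part_on_def
  by (rule cSup_least) (use assms ideal in \<open>auto simp: sum_ideal_def intro!: exI[of _ 0]\<close>)

lemma positive_part_nonneg: "0 \<le> positive_part_on J f x"
  using positive_part_upper[of 0 x] additive_on_zero[OF add] ideal by (simp add: sum_ideal_def)

lemma additive_positive_part: "additive_on UNIV (positive_part_on J f)"
  unfolding additive_on_def
proof (intro ballI impI antisym)
  fix x y :: 'a assume xy: "summable_pair x y"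
  let ?F = "positive_part_on J f"
  show "?F (x \<oplus> y) \<le> ?F x + ?F y"
  proof (rule positive_part_least)
    fix v assume v: "v \<in> J" "v \<sqsubseteq> x \<oplus> y"
    then obtain w where w: "summable_pair v w" "v \<oplus> w = x \<oplus> y" unfolding sum_le_def by blast
    obtain a b c d where r: "summable_pair a b" "v = a \<oplus> b" "summable_pair a c" "x = a \<oplus> c"
      "summable_pair b d" "y = b \<oplus> d"
      using disjoint_refinement[OF w(1) xy w(2)] by metis
    have "a \<in> J" "b \<in> J" using v(1) r(1,2) ideal sum_le_oplus unfolding sum_ideal_def by blast+
    then show "f v \<le> ?F x + ?F y"
      using additive_onD[OF add, of a b] positive_part_upper[of a x] positive_part_upper[of b y] r
        sum_le_oplus(1) by fastforce
  qed
  \<comment> \<open>The two suprema are taken one after the other, each with the other element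
    fixed.\<close>
  have "f v \<le> ?F (x \<oplus> y) - ?F x" if v: "v \<in> J" "v \<sqsubseteq> y" for v
  proof -
    have "?F x \<le> ?F (x \<oplus> y) - f v"
    proof (rule positive_part_least)
      fix w assume w: "w \<in> J" "w \<sqsubseteq> x"
      have "summable_pair w v" using summable_pair_mono[OF xy w(2) v(2)] .
      moreover have "w \<oplus> v \<in> J" using ideal v w calculation unfolding sum_ideal_def by blast
      ultimately show "f w \<le> ?F (x \<oplus> y) - f v"
        using positive_part_upper[of "w \<oplus> v" "x \<oplus> y"] oplus_sum_le_mono[OF xy w(2) v(2)]
          additive_onD[OF add w(1) v(1)] by simp
    qed
    then show ?thesis by simp
  qed
  then have "?F y \<le> ?F (x \<oplus> y) - ?F x" by (rule positive_part_least)
  then show "?F x + ?F y \<le> ?F (x \<oplus> y)" by simp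
qed

end

text \<open>An attained maximum is what the normalisation \<open>s a = 1\<close> of a state becomes
  under scaling; boundedness alone would be weaker when M has no top.\<close>

definition measure_cone :: "('a::emv_algebra \<Rightarrow> real) set"
  where "measure_cone = {m. additive_on UNIV m \<and> (\<forall>x. 0 \<le> m x) \<and> (\<exists>a. \<forall>x. m x \<le> m a)}"

lemma additive_mono:
  assumes "additive_on UNIV m" "\<And>x. 0 \<le> m x" "x \<sqsubseteq> y"
  shows "m x \<le> m y"
  using additive_on_mono[OF assms(1)] assms(2,3) by simp

lemma emv_state_iff:
  "emv_state s \<longleftrightarrow> range s \<subseteq> {0..1} \<and> additive_on UNIV s \<and> (\<exists>a. s a = 1)"
  unfolding emv_state_def additive_on_def by simp

lemma state_space_cone: "(state_space :: ('a::emv_algebra \<Rightarrow> real) set) \<subseteq> measure_cone"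
proof
  fix s :: "'a \<Rightarrow> real" assume "s \<in> state_space"
  then have s: "additive_on UNIV s" "\<And>x. 0 \<le> s x" "\<And>x. s x \<le> 1" "\<exists>a. s a = 1"
    by (simp_all add: state_space_def emv_state_iff image_subset_iff)
  then have "\<exists>a. \<forall>x. s x \<le> s a" by metis
  then show "s \<in> measure_cone" using s unfolding measure_cone_def by blast
qed

lemma measure_cone_idempotent:
  assumes "m \<in> measure_cone"
  obtains a where "idempotent a" "\<And>x. m x \<le> m a"
proof -
  obtain b where b: "\<And>x. m x \<le> m b" and m: "additive_on UNIV m" "\<And>x. 0 \<le> m x"
    using assms unfolding measure_cone_def by auto
  obtain a where a: "idempotent a" "b \<le> a" using below_idempotent by blast
  then have "m b \<le> m a" using additive_mono[OF m] sum_le_idempotent by blast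
  then show ?thesis using that[OF a(1)] b order_trans by blast
qed

lemma measure_cone_attains:
  assumes "m \<in> measure_cone" "idempotent a" "\<And>x. m x \<le> m a" "idempotent b" "a \<le> b"
  shows "m x \<le> m b"
proof -
  have "m a \<le> m b"
    using assms additive_mono[of m a b] sum_le_idempotent[of b a] unfolding measure_cone_def by auto
  then show ?thesis using assms(3) order_trans by blast
qed

lemma measure_cone_add:
  assumes "m \<in> measure_cone" "n \<in> measure_cone"
  shows "m + n \<in> measure_cone"
proof -
  obtain a where a: "idempotent a" "\<And>x. m x \<le> m a" by (rule measure_cone_idempotent[OF assms(1)]) blast
  obtain b where b: "idempotent b" "\<And>x. n x \<le> n b" by (rule measure_cone_idempotent[OF assms(2)]) blast
  \<comment> \<open>The two maxima may be attained at different places; at an idempotent above both,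
    each function is still maximal.\<close>
  obtain e where e: "idempotent e" "a \<le> e" "b \<le> e" by (rule idempotent_bound2)
  have "(m + n) x \<le> (m + n) e" for x
    using measure_cone_attains[OF assms(1) a e(1,2)] measure_cone_attains[OF assms(2) b e(1,3)]
    by (simp add: add_mono)
  then show ?thesis using assms by (auto simp: measure_cone_def additive_on_def)
qed

lemma measure_cone_scale:
  assumes "m \<in> measure_cone" "0 \<le> c"
  shows "c *\<^sub>R m \<in> measure_cone"
proof -
  obtain a where "\<And>x. m x \<le> m a" using assms(1) unfolding measure_cone_def by blast
  then have "\<forall>x. c * m x \<le> c * m a" using assms(2) by (simp add: mult_left_mono)
  then show ?thesis
    using assms unfolding measure_cone_def additive_on_def by (auto simp: algebra_simps)
qed

lemma measure_cone_zero: "0 \<in> measure_cone"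
  unfolding measure_cone_def additive_on_def by simp

text \<open>If n is maximal at the idempotent a, it vanishes on the complement of a in any larger
  idempotent. So does m, which is therefore maximal at a too.\<close>

lemma measure_cone_below:
  assumes n: "n \<in> measure_cone" and m: "additive_on UNIV m" "\<And>x. 0 \<le> m x" "\<And>x. m x \<le> n x"
  shows "m \<in> measure_cone"
proof -
  obtain a where a: "idempotent a" "\<And>x. n x \<le> n a" by (rule measure_cone_idempotent[OF n]) blast
  have "m x \<le> m a" for x
  proof -
    obtain b where b: "idempotent b" "x \<le> b" "a \<le> b" by (rule idempotent_bound2)
    then obtain w where w: "summable_pair a w" "a \<oplus> w = b"
      using sum_le_idempotent unfolding sum_le_def by blast
    have "n b = n a + n w" using n w unfolding measure_cone_def additive_on_def by auto
    then have "m w \<le> 0" using a(2)[of b] m(3)[of w] by simp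
    moreover have "m b = m a + m w" using m(1) w unfolding additive_on_def by auto
    moreover have "m x \<le> m b" using additive_mono[OF m(1,2)] b sum_le_idempotent by blast
    ultimately show ?thesis by simp
  qed
  then show ?thesis using m unfolding measure_cone_def by blast
qed

lemma additive_on_diff: "additive_on J m \<Longrightarrow> additive_on J n \<Longrightarrow> additive_on J (m - n)"
  unfolding additive_on_def by simp

lemma additive_on_add: "additive_on J m \<Longrightarrow> additive_on J n \<Longrightarrow> additive_on J (m + n)"
  unfolding additive_on_def by simp

lemma measure_coneD:
  assumes "m \<in> measure_cone"
  shows "additive_on UNIV m" "0 \<le> m x" "x \<sqsubseteq> y \<Longrightarrow> m x \<le> m y"
  using assms additive_mono[of m x y] unfolding measure_cone_def by auto

text \<open>If m is pointwise below n, then \<open>n - m\<close> is additive, non-negative and below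
  n, so \<open>measure_cone_below\<close> supplies its attained maximum.\<close>

lemma cone_le_measure_cone_iff:
  assumes "m \<in> measure_cone" "n \<in> measure_cone"
  shows "cone_le measure_cone m n \<longleftrightarrow> (\<forall>x. m x \<le> n x)"
proof
  assume le: "\<forall>x. m x \<le> n x"
  have "additive_on UNIV (n - m)"
    using measure_coneD(1)[OF assms(1)] measure_coneD(1)[OF assms(2)] additive_on_diff by blast
  then show "cone_le measure_cone m n"
    unfolding cone_le_def
    by (rule measure_cone_below[OF assms(2)]) (simp_all add: le measure_coneD(2)[OF assms(1)])
next
  assume "cone_le measure_cone m n"
  then have "0 \<le> (n - m) x" for x unfolding cone_le_def by (rule measure_coneD(2))
  then show "\<forall>x. m x \<le> n x" by simp
qed

lemma lattice_measure_cone: "lattice_cone (measure_cone :: ('a::emv_algebra \<Rightarrow> real) set)"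
  unfolding lattice_cone_def
proof (intro conjI ballI)
  show "convex_cone (measure_cone :: ('a \<Rightarrow> real) set)"
    unfolding convex_cone_def convex_def conic_def
    using measure_cone_add measure_cone_scale measure_cone_zero by blast
  have "m = 0" if "m \<in> measure_cone" "- m \<in> measure_cone" for m :: "'a \<Rightarrow> real"
    using measure_coneD(2)[OF that(1)] measure_coneD(2)[OF that(2)]
    by (intro ext) (simp add: antisym)
  then show "strict_cone (measure_cone :: ('a \<Rightarrow> real) set)"
    unfolding strict_cone_def using measure_cone_zero by (auto intro!: image_eqI[of _ _ 0])
next
  fix m n :: "'a \<Rightarrow> real" assume mn: "m \<in> measure_cone" "n \<in> measure_cone"
  note m = measure_coneD[OF mn(1)] and n = measure_coneD[OF mn(2)]
  \<comment> \<open>As in a vector lattice, the join is \<open>m + F\<close> and the meet is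
    \<open>n - F\<close>. Both lie below \<open>m + n\<close> or n, which puts them into the
    cone.\<close>
  define F where "F = positive_part_on UNIV (n - m)"
  have add: "additive_on UNIV (n - m)" by (intro additive_on_diff m n)
  have diff_le: "(n - m) y \<le> n x" if "y \<sqsubseteq> x" for x y
    using m(2)[of y] n(3)[OF that] by simp
  have bdd: "bdd_above ((n - m) ` {y \<in> UNIV. y \<sqsubseteq> x})" for x
    using diff_le by (intro bdd_aboveI2[of _ _ "n x"]) blast
  note pos = positive_part_upper[OF sum_ideal_UNIV add bdd, folded F_def]
    positive_part_least[OF sum_ideal_UNIV add bdd, folded F_def]
    positive_part_nonneg[OF sum_ideal_UNIV add bdd, folded F_def]
    additive_positive_part[OF sum_ideal_UNIV add bdd, folded F_def]
  have Fn: "F x \<le> n x" for x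
    using diff_le by (rule pos(2))
  have Fnm: "n x - m x \<le> F x" for x using pos(1)[of x x] by simp
  \<comment> \<open>For an upper bound w, the difference \<open>w - m\<close> is in the cone and
    hence monotone, so its value at x bounds \<open>n - m\<close> at every y below x. The meet is
    treated likewise with \<open>n - w\<close>.\<close>
  have F_le: "F x \<le> w x - m x"
    if w: "w \<in> measure_cone" "\<forall>x. m x \<le> w x" "\<forall>x. n x \<le> w x" for w x
  proof (rule pos(2))
    fix y assume "y \<sqsubseteq> x"
    have "w - m \<in> measure_cone" using cone_le_measure_cone_iff[OF mn(1) w(1)] w(2) by (simp add: cone_le_def)
    from measure_coneD(3)[OF this \<open>y \<sqsubseteq> x\<close>] show "(n - m) y \<le> w x - m x"
      using w(3)[rule_format, of y] by simp
  qed
  have F_le': "F x \<le> n x - w x"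
    if w: "w \<in> measure_cone" "\<forall>x. w x \<le> m x" "\<forall>x. w x \<le> n x" for w x
  proof (rule pos(2))
    fix y assume "y \<sqsubseteq> x"
    have "n - w \<in> measure_cone" using cone_le_measure_cone_iff[OF w(1) mn(2)] w(3) by (simp add: cone_le_def)
    from measure_coneD(3)[OF this \<open>y \<sqsubseteq> x\<close>] show "(n - m) y \<le> n x - w x"
      using w(2)[rule_format, of y] by simp
  qed
  have sup: "m + F \<in> measure_cone"
    by (rule measure_cone_below[OF measure_cone_add[OF mn] additive_on_add[OF m(1) pos(4)]])
      (simp_all add: m(2) pos(3) Fn)
  have inf: "n - F \<in> measure_cone"
    by (rule measure_cone_below[OF mn(2) additive_on_diff[OF n(1) pos(4)]])
      (simp_all add: n(2) pos(3) Fn)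
  show "\<exists>z\<in>measure_cone. cone_le measure_cone m z \<and> cone_le measure_cone n z \<and>
      (\<forall>w\<in>measure_cone. cone_le measure_cone m w \<and> cone_le measure_cone n w \<longrightarrow>
        cone_le measure_cone z w)"
  proof (rule bexI[OF _ sup])
    show "cone_le measure_cone m (m + F) \<and> cone_le measure_cone n (m + F) \<and>
      (\<forall>w\<in>measure_cone. cone_le measure_cone m w \<and> cone_le measure_cone n w \<longrightarrow>
        cone_le measure_cone (m + F) w)"
    proof (intro conjI ballI impI; (elim conjE)?)
      show "cone_le measure_cone m (m + F)" "cone_le measure_cone n (m + F)"
        unfolding cone_le_measure_cone_iff[OF mn(1) sup] cone_le_measure_cone_iff[OF mn(2) sup]
        using pos(3) Fnm by (simp_all add: diff_le_eq add.commute)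
    next
      fix w :: "'a \<Rightarrow> real"
      assume w: "w \<in> measure_cone" "cone_le measure_cone m w" "cone_le measure_cone n w"
      then have "F x \<le> w x - m x" for x
        by (intro F_le) (simp_all add: cone_le_measure_cone_iff mn)
      then show "cone_le measure_cone (m + F) w"
        unfolding cone_le_measure_cone_iff[OF sup w(1)] by (simp add: le_diff_eq add.commute)
    qed
  qed
  show "\<exists>z\<in>measure_cone. cone_le measure_cone z m \<and> cone_le measure_cone z n \<and>
      (\<forall>w\<in>measure_cone. cone_le measure_cone w m \<and> cone_le measure_cone w n \<longrightarrow>
        cone_le measure_cone w z)"
  proof (rule bexI[OF _ inf])
    show "cone_le measure_cone (n - F) m \<and> cone_le measure_cone (n - F) n \<and>
      (\<forall>w\<in>measure_cone. cone_le measure_cone w m \<and> cone_le measure_cone w n \<longrightarrow>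
        cone_le measure_cone w (n - F))"
    proof (intro conjI ballI impI; (elim conjE)?)
      show "cone_le measure_cone (n - F) m" "cone_le measure_cone (n - F) n"
        unfolding cone_le_measure_cone_iff[OF inf mn(1)] cone_le_measure_cone_iff[OF inf mn(2)]
        using pos(3) Fnm by (simp_all add: diff_le_eq add.commute)
    next
      fix w :: "'a \<Rightarrow> real"
      assume w: "w \<in> measure_cone" "cone_le measure_cone w m" "cone_le measure_cone w n"
      then have "F x \<le> n x - w x" for x
        by (intro F_le') (simp_all add: cone_le_measure_cone_iff mn)
      then show "cone_le measure_cone w (n - F)"
        unfolding cone_le_measure_cone_iff[OF w(1) inf] by (simp add: le_diff_eq add.commute)
    qed
  qed
qed

section \<open>States as a base of the cone\<close>

lemma state_spaceD:
  assumes "s \<in> state_space"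
  shows "additive_on UNIV s" "0 \<le> s x" "s x \<le> 1" "x \<sqsubseteq> y \<Longrightarrow> s x \<le> s y"
  using assms measure_coneD(3)[OF subsetD[OF state_space_cone assms]]
  by (simp_all add: state_space_def emv_state_iff image_subset_iff)

lemma state_space_attains:
  assumes "s \<in> state_space"
  obtains a where "idempotent a" "s a = 1"
proof -
  have cone: "s \<in> measure_cone" using assms state_space_cone by blast
  obtain a where a: "idempotent a" "\<And>x. s x \<le> s a" by (rule measure_cone_idempotent[OF cone]) blast
  moreover obtain b where "s b = 1" using assms unfolding state_space_def emv_state_iff by blast
  ultimately have "s a = 1" using state_spaceD(3)[OF assms, of a] a(2)[of b] by simp
  then show ?thesis using that a(1) by blast
qed

lemma state_spaceI:
  assumes "s \<in> measure_cone" "\<And>x. s x \<le> 1" "s a = 1"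
  shows "s \<in> state_space"
  using assms by (auto simp: state_space_def emv_state_iff measure_cone_def)

lemma convex_state_space: "convex (state_space :: ('a::emv_algebra \<Rightarrow> real) set)"
  unfolding convex_def
proof (intro ballI allI impI)
  fix s t :: "'a \<Rightarrow> real" and u v :: real
  assume st: "s \<in> state_space" "t \<in> state_space" and uv: "0 \<le> u" "0 \<le> v" "u + v = 1"
  note s = state_spaceD[OF st(1)] and t = state_spaceD[OF st(2)]
  obtain a where a: "idempotent a" "s a = 1" by (rule state_space_attains[OF st(1)])
  obtain b where b: "idempotent b" "t b = 1" by (rule state_space_attains[OF st(2)])
  obtain e where e: "idempotent e" "a \<le> e" "b \<le> e" by (rule idempotent_bound2)
  have "s e = 1" "t e = 1"
    using s(3)[of e] s(4)[of a e] t(3)[of e] t(4)[of b e] a b e sum_le_idempotent by fastforce+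
  then have "(u *\<^sub>R s + v *\<^sub>R t) e = 1" using uv by simp
  moreover have "u *\<^sub>R s + v *\<^sub>R t \<in> measure_cone"
    using subsetD[OF state_space_cone st(1)] subsetD[OF state_space_cone st(2)] uv
    by (intro measure_cone_add[OF measure_cone_scale measure_cone_scale])
  moreover have "(u *\<^sub>R s + v *\<^sub>R t) x \<le> 1" for x
    using convex_bound_le[OF s(3) t(3) uv] by simp
  ultimately show "u *\<^sub>R s + v *\<^sub>R t \<in> state_space" by (intro state_spaceI[of _ e])
qed

text \<open>A state has maximum 1, so the only possible factor of m is its own maximum.\<close>

lemma base_state_space: "base_of_cone measure_cone (state_space :: ('a::emv_algebra \<Rightarrow> real) set)"
  unfolding base_of_cone_def
proof (intro conjI ballI convex_state_space state_space_cone)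
  fix m :: "'a \<Rightarrow> real" assume m: "m \<in> measure_cone - {0}"
  then obtain a where a: "\<And>x. m x \<le> m a" by (auto simp: measure_cone_def)
  have nn: "0 \<le> m x" for x using measure_coneD(2) m by blast
  have pos: "0 < m a"
  proof (rule ccontr)
    assume "\<not> 0 < m a"
    then have "m = 0" using a nn by (intro ext) (metis antisym not_less order_trans zero_fun_apply)
    with m show False by simp
  qed
  show "\<exists>!(c, s). 0 < c \<and> s \<in> state_space \<and> m = c *\<^sub>R s"
  proof (rule ex1I[of _ "(m a, inverse (m a) *\<^sub>R m)"])
    have "inverse (m a) *\<^sub>R m \<in> state_space"
      using m pos a by (intro state_spaceI[of _ a] measure_cone_scale) (auto simp: field_simps)
    then show "case (m a, inverse (m a) *\<^sub>R m) of (c, s) \<Rightarrow> 0 < c \<and> s \<in> state_space \<and> m = c *\<^sub>R s"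
      using pos by simp
  next
    fix p :: "real \<times> ('a \<Rightarrow> real)"
    assume "case p of (c, s) \<Rightarrow> 0 < c \<and> s \<in> state_space \<and> m = c *\<^sub>R s"
    then obtain c s where p: "p = (c, s)" "0 < c" "s \<in> state_space" "m = c *\<^sub>R s" by auto
    obtain b where b: "s b = 1" using state_space_attains[OF p(3)] by blast
    have "c \<le> m a" using a[of b] p b by simp
    moreover have "m a \<le> c" using p state_spaceD(3)[OF p(3), of a] by simp
    ultimately show "p = (m a, inverse (m a) *\<^sub>R m)" using p by simp
  qed
qed

lemma simplex_state_space: "is_simplex (state_space :: ('a::emv_algebra \<Rightarrow> real) set)"
proof (rule is_simplexI[OF convex_state_space lattice_measure_cone base_state_space])
  show "affinely_isomorphic (state_space :: ('a \<Rightarrow> real) set) (state_space :: ('a \<Rightarrow> real) set)"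
    unfolding affinely_isomorphic_def by (rule exI[of _ "\<lambda>x :: 'a \<Rightarrow> real. x"]) (auto simp: bij_betw_def)
qed

section \<open>State spaces in the presence of a top element\<close>

lemma closed_coordinate: "closed S \<Longrightarrow> closed {s :: 'a \<Rightarrow> real. s x \<in> S}"
  using closed_vimage[OF _ continuous_on_product_coordinates] by (simp add: vimage_def)

lemma top_idempotent: "(\<And>x :: 'a::emv_algebra. x \<le> t) \<Longrightarrow> idempotent t"
  using below_idempotent[of t] by (metis antisym)

lemma state_space_top:
  fixes t :: "'a::emv_algebra"
  assumes top: "\<And>x. x \<le> t"
  shows "(state_space :: ('a \<Rightarrow> real) set) = {s. range s \<subseteq> {0..1} \<and> additive_on UNIV s \<and> s t = 1}"
proof -
  have "s t = 1" if s: "s \<in> state_space" for s :: "'a \<Rightarrow> real"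
  proof -
    obtain a where "idempotent a" "s a = 1" by (rule state_space_attains[OF s])
    then show ?thesis
      using state_spaceD(3)[OF s, of t] state_spaceD(4)[OF s, of a t]
        sum_le_idempotent[OF top_idempotent[OF top], of a] top by simp
  qed
  then show ?thesis by (auto simp: state_space_def emv_state_iff)
qed

lemma compact_state_space:
  fixes t :: "'a::emv_algebra"
  assumes top: "\<And>x. x \<le> t"
  shows "compact (state_space :: ('a \<Rightarrow> real) set)"
proof -
  have "compactin (product_topology (\<lambda>_. euclidean) UNIV) (\<Pi>\<^sub>E x\<in>(UNIV :: 'a set). {0..1::real})"
    by (simp add: compactin_PiE)
  then have cube: "compact (\<Pi>\<^sub>E x\<in>(UNIV :: 'a set). {0..1::real})"
    by (simp add: euclidean_product_topology)
  have "closed {s :: 'a \<Rightarrow> real. s (x \<oplus> y) = s x + s y}" for x y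
    by (intro closed_Collect_eq continuous_intros continuous_on_product_coordinates)
  then have add: "closed (\<Inter>(x, y)\<in>{(x, y). summable_pair x y}. {s :: 'a \<Rightarrow> real. s (x \<oplus> y) = s x + s y})"
    by (intro closed_INT) auto
  have "state_space = (\<Pi>\<^sub>E x\<in>UNIV. {0..1}) \<inter> ((\<Inter>(x, y)\<in>{(x, y). summable_pair x y}.
    {s :: 'a \<Rightarrow> real. s (x \<oplus> y) = s x + s y}) \<inter> {s. s t \<in> {1}})"
    unfolding state_space_top[OF top] additive_on_def by (auto simp: PiE_iff)
  then show ?thesis
    using compact_Int_closed[OF cube closed_Int[OF add closed_coordinate[of "{1}" t]]] by simp
qed

text \<open>Among positive functionals on a vector lattice, the analogous condition singles out the
  lattice homomorphisms. Here disjointness refers to \<open>\<sqsubseteq>\<close>.\<close>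

definition disjointness_preserving :: "('a::emv_algebra \<Rightarrow> real) \<Rightarrow> bool"
  where "disjointness_preserving s \<longleftrightarrow>
    (\<forall>x y. (\<forall>w. w \<sqsubseteq> x \<longrightarrow> w \<sqsubseteq> y \<longrightarrow> w = 0) \<longrightarrow> s x = 0 \<or> s y = 0)"

lemma sum_ideal_polar:
  fixes y :: "'a::emv_algebra"
  shows "sum_ideal {x. \<forall>w. w \<sqsubseteq> x \<longrightarrow> w \<sqsubseteq> y \<longrightarrow> w = 0}" (is "sum_ideal ?J")
  unfolding sum_ideal_def
proof (intro conjI allI ballI impI)
  show "0 \<in> ?J" using sum_le_zero by blast
  show "v \<in> ?J" if "x \<in> ?J" "v \<sqsubseteq> x" for x v using that sum_le_trans by blast
  fix p q assume pq: "p \<in> ?J" "q \<in> ?J" "summable_pair p q"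
  have "w = 0" if w: "w \<sqsubseteq> p \<oplus> q" "w \<sqsubseteq> y" for w
  proof -
    obtain v where v: "summable_pair w v" "w \<oplus> v = p \<oplus> q" using w(1) unfolding sum_le_def by blast
    obtain a b c d where r: "summable_pair a b" "w = a \<oplus> b" "summable_pair c d" "v = c \<oplus> d"
      "summable_pair a c" "p = a \<oplus> c" "summable_pair b d" "q = b \<oplus> d"
      "\<forall>w. w \<sqsubseteq> b \<longrightarrow> w \<sqsubseteq> c \<longrightarrow> w = 0"
      by (rule disjoint_refinement[OF v(1) pq(3) v(2)])
    have "a \<sqsubseteq> y" "b \<sqsubseteq> y" using w(2) r(1,2) sum_le_oplus sum_le_trans by blast+
    moreover have "a \<sqsubseteq> p" "b \<sqsubseteq> q" using r sum_le_oplus by blast+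
    ultimately have "a = 0" "b = 0" using pq(1,2) by blast+
    then show "w = 0" using r(2) by simp
  qed
  then show "p \<oplus> q \<in> ?J" by blast
qed

lemma additive_on_scale: "additive_on J m \<Longrightarrow> additive_on J (c *\<^sub>R m)"
  unfolding additive_on_def by (simp add: algebra_simps)

lemma state_of_additive:
  fixes t :: "'a::emv_algebra"
  assumes top: "\<And>x. x \<le> t" and m: "additive_on UNIV m" "\<And>x. 0 \<le> m x" "0 < m t"
  shows "inverse (m t) *\<^sub>R m \<in> state_space"
proof -
  have "m x \<le> m t" for x
    using additive_mono[OF m(1,2)] sum_le_idempotent[OF top_idempotent[OF top]] top by blast
  then show ?thesis
    unfolding state_space_top[OF top] using m
    by (auto simp: image_subset_iff field_simps intro!: additive_on_scale)
qed

text \<open>If s were positive at both x and y, its component m in the polar of y would be non-zero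
  because of x, and \<open>s - m\<close> because of y. Their normalisations have s strictly between
  them, and they differ at y, where only the first one vanishes.\<close>

lemma extreme_state_disjointness_preserving:
  fixes t :: "'a::emv_algebra" and s :: "'a \<Rightarrow> real"
  assumes top: "\<And>x. x \<le> t" and ext: "s extreme_point_of state_space"
  shows "disjointness_preserving s"
  unfolding disjointness_preserving_def
proof (intro allI impI, rule ccontr)
  fix x y :: 'a
  assume disj: "\<forall>w. w \<sqsubseteq> x \<longrightarrow> w \<sqsubseteq> y \<longrightarrow> w = 0" and "\<not> (s x = 0 \<or> s y = 0)"
  have s: "s \<in> state_space" using ext by (simp add: extreme_point_of_def)
  note sD = state_spaceD[OF s]
  have pos: "0 < s x" "0 < s y" using \<open>\<not> _\<close> sD(2)[of x] sD(2)[of y] by linarith+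
  define J where "J = {x. \<forall>w. w \<sqsubseteq> x \<longrightarrow> w \<sqsubseteq> y \<longrightarrow> w = 0}"
  have J: "sum_ideal J" unfolding J_def by (rule sum_ideal_polar)
  have add: "additive_on J s" using sD(1) unfolding additive_on_def by blast
  have bdd: "bdd_above (s ` {y \<in> J. y \<sqsubseteq> x})" for x
    using sD(3) by (intro bdd_aboveI2[of _ _ 1])
  text \<open>The component of \<open>s\<close> in the band of the elements disjoint from \<open>y\<close>.\<close>
  define m where "m = positive_part_on J s"
  note mD = positive_part_upper[OF J add bdd, folded m_def]
    positive_part_least[OF J add bdd, folded m_def]
    positive_part_nonneg[OF J add bdd, folded m_def]
    additive_positive_part[OF J add bdd, folded m_def]
  have le: "m v \<le> s v" for v using sD(4) by (rule mD(2))
  have "x \<in> J" using disj by (simp add: J_def)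
  then have "s x \<le> m x" by (rule mD(1)) simp
  moreover have "m v \<le> m t" for v
    using additive_mono[OF mD(4,3)] sum_le_idempotent[OF top_idempotent[OF top]] top by blast
  ultimately have mt: "0 < m t" using pos(1) by (metis less_le_trans)
  have my: "m y = 0"
  proof -
    have "m y \<le> 0"
    proof (rule mD(2))
      fix v assume v: "v \<in> J" "v \<sqsubseteq> y"
      then have "v = 0" unfolding J_def using sum_le_refl by blast
      then show "s v \<le> 0" using additive_on_zero[OF sD(1)] by simp
    qed
    then show ?thesis using mD(3)[of y] by simp
  qed
  define n where "n = s - m"
  have nD: "additive_on UNIV n" "0 \<le> n v" for v
    unfolding n_def using le[of v] additive_on_diff[OF sD(1) mD(4)] by simp_all
  have st: "s t = 1" using s state_space_top[OF top] by auto
  have "0 < n y" using my pos(2) by (simp add: n_def)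
  also have "n y \<le> n t"
    using additive_mono[OF nD] sum_le_idempotent[OF top_idempotent[OF top]] top by blast
  finally have nt: "0 < n t" .
  have sum: "m t + n t = 1" using st by (simp add: n_def)
  define a where "a = inverse (m t) *\<^sub>R m"
  define b where "b = inverse (n t) *\<^sub>R n"
  have "a \<in> state_space" "b \<in> state_space"
    unfolding a_def b_def using state_of_additive[OF top] mD(3,4) mt nD nt by blast+
  moreover have "s \<in> open_segment a b"
  proof -
    have "a y = 0" "0 < b y" using my \<open>0 < n y\<close> nt by (simp_all add: a_def b_def)
    then have "a \<noteq> b" by auto
    moreover have "s = (1 - n t) *\<^sub>R a + n t *\<^sub>R b"
      using mt nt sum by (auto simp: a_def b_def n_def fun_eq_iff eq_diff_eq[symmetric])
    ultimately show ?thesis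
      using nt mt sum unfolding in_segment by (auto intro!: exI[of _ "n t"])
  qed
  ultimately show False using ext unfolding extreme_point_of_def by blast
qed

text \<open>\<open>k\<close> and \<open>s z\<close> are the integer and the fractional part of \<open>n s(x)\<close>. They can be computed in
  \<open>M\<close> by adding \<open>x\<close> repeatedly modulo \<open>t\<close>, and \<open>m\<close> follows this computation since it vanishes where
  \<open>s\<close> does.\<close>

lemma multiple_decomposition:
  fixes t :: "'a::emv_algebra" and s m :: "'a \<Rightarrow> real"
  assumes top: "\<And>x. x \<le> t" and s: "additive_on UNIV s" "s t = 1" "disjointness_preserving s"
    and m: "additive_on UNIV m" "m t = 1" "\<And>w. s w = 0 \<Longrightarrow> m w = 0"
  shows "\<exists>z (k :: nat). s z = real n * s x - real k \<and> m z = real n * m x - real k"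
proof (induction n)
  case 0
  have "s 0 = 0" "m 0 = 0" using s(1) m(1) additive_on_zero by blast+
  then show ?case by (intro exI[of _ 0]) simp
next
  case (Suc n)
  then obtain z k where z: "s z = real n * s x - real k" "m z = real n * m x - real k" by blast
  have "x \<sqsubseteq> t" "z \<sqsubseteq> t" using sum_le_idempotent[OF top_idempotent[OF top]] top by blast+
  then obtain x' z' where x': "summable_pair x' x" "x' \<oplus> x = t"
    and z': "summable_pair z z'" "z \<oplus> z' = t"
    unfolding sum_le_def by (metis oplus_commute summable_pair_commute)
  \<comment> \<open>Adding x to z means adding s(a) + 2 s(b) + s(d), while a, b, c, d add up to t.
    As b and c are disjoint, s kills one of them: if s(b) = 0 there is no carry and the new z is
    \<open>a \<oplus> d\<close>; if s(c) = 0 then s(a) + s(b) + s(d) = 1 is carried and b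
    remains.\<close>
  obtain a b c d where r: "summable_pair a b" "z = a \<oplus> b" "summable_pair c d" "z' = c \<oplus> d"
    "summable_pair a c" "x' = a \<oplus> c" "summable_pair b d" "x = b \<oplus> d"
    "\<forall>w. w \<sqsubseteq> b \<longrightarrow> w \<sqsubseteq> c \<longrightarrow> w = 0"
    by (rule disjoint_refinement[OF z'(1) x'(1)]) (simp add: z' x')
  have vals: "f z = f a + f b" "f x = f b + f d" "f a + f b + f c + f d = f t"
    if "additive_on UNIV f" for f
  proof -
    have f: "f (p \<oplus> q) = f p + f q" if "summable_pair p q" for p q
      using additive_onD[OF \<open>additive_on UNIV f\<close>] that by simp
    have "f t = f z + f z'" using f[OF z'(1)] z'(2) by simp
    then show "f z = f a + f b" "f x = f b + f d" "f a + f b + f c + f d = f t"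
      using f[OF r(1)] f[OF r(3)] f[OF r(7)] r by simp_all
  qed
  note sv = vals[OF s(1)] and mv = vals[OF m(1)]
  have "s b = 0 \<or> s c = 0" using s(3) r(9) unfolding disjointness_preserving_def by blast
  then show ?case
  proof
    assume b: "s b = 0"
    \<comment> \<open>a is a part of z and d is a part of its complement z'.\<close>
    have ad: "summable_pair a d"
      using summable_pair_mono[OF z'(1)] r sum_le_oplus by metis
    have "s (a \<oplus> d) = s a + s d" "m (a \<oplus> d) = m a + m d"
      using additive_onD[OF s(1) _ _ ad] additive_onD[OF m(1) _ _ ad] by simp_all
    then show ?thesis
      using b m(3)[OF b] sv mv z by (intro exI[of _ "a \<oplus> d"] exI[of _ k]) (simp add: algebra_simps)
  next
    assume c: "s c = 0"
    then show ?thesis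
      using m(3)[OF c] sv mv z s(2) m(2)
      by (intro exI[of _ b] exI[of _ "Suc k"]) (simp add: algebra_simps)
  qed
qed

text \<open>The same z and k serve s and m, so n times the difference of s and m at x is their
  difference at z, which is at most 1 for every n.\<close>

lemma disjointness_preserving_unique:
  fixes t :: "'a::emv_algebra" and s m :: "'a \<Rightarrow> real"
  assumes top: "\<And>x. x \<le> t" and s: "s \<in> state_space" "disjointness_preserving s"
    and m: "m \<in> state_space" "\<And>w. s w = 0 \<Longrightarrow> m w = 0"
  shows "m = s"
proof
  fix x
  have st: "s t = 1" "m t = 1" using s m state_space_top[OF top] by auto
  have "real n * \<bar>m x - s x\<bar> \<le> 1" for n
  proof -
    obtain z k where z: "s z = real n * s x - real k" "m z = real n * m x - real k"
      using multiple_decomposition[OF top state_spaceD(1)[OF s(1)] st(1) s(2)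
          state_spaceD(1)[OF m(1)] st(2) m(2)] by blast
    have "real n * (m x - s x) = m z - s z" using z by (simp add: algebra_simps)
    then have "real n * \<bar>m x - s x\<bar> = \<bar>m z - s z\<bar>" by (metis abs_mult abs_of_nat)
    then show ?thesis
      using state_spaceD(2,3)[OF s(1), of z] state_spaceD(2,3)[OF m(1), of z] by linarith
  qed
  then have "\<bar>m x - s x\<bar> = 0" using reals_Archimedean3 abs_ge_zero
    by (metis less_eq_real_def not_less)
  then show "m x = s x" by simp
qed

text \<open>In a proper convex combination of states, both of them vanish wherever s does, so both
  equal s by uniqueness.\<close>

lemma disjointness_preserving_extreme:
  fixes t :: "'a::emv_algebra" and s :: "'a \<Rightarrow> real"
  assumes top: "\<And>x. x \<le> t" and s: "s \<in> state_space" "disjointness_preserving s"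
  shows "s extreme_point_of state_space"
  unfolding extreme_point_of_def
proof (intro conjI s(1) ballI notI)
  fix a b assume ab: "a \<in> state_space" "b \<in> state_space" and "s \<in> open_segment a b"
  then obtain u where u: "0 < u" "u < 1" "s = (1 - u) *\<^sub>R a + u *\<^sub>R b" "a \<noteq> b"
    unfolding in_segment by blast
  have "a w = 0 \<and> b w = 0" if "s w = 0" for w
  proof -
    have "(1 - u) * a w + u * b w = 0" using u(3) that by (metis plus_fun_apply scaleR_fun_apply real_scaleR_def)
    moreover have "0 \<le> (1 - u) * a w" "0 \<le> u * b w"
      using u state_spaceD(2)[OF ab(1), of w] state_spaceD(2)[OF ab(2), of w] by simp_all
    ultimately have "(1 - u) * a w = 0" "u * b w = 0" by linarith+
    then show ?thesis using u by simp
  qed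
  then have "a = s" "b = s" using disjointness_preserving_unique[OF top s] ab by blast+
  with u(4) show False by simp
qed

lemma compact_extreme_states:
  fixes t :: "'a::emv_algebra"
  assumes top: "\<And>x. x \<le> t"
  shows "compact {s. s extreme_point_of (state_space :: ('a \<Rightarrow> real) set)}"
proof -
  define D where "D = {(x :: 'a, y). \<forall>w. w \<sqsubseteq> x \<longrightarrow> w \<sqsubseteq> y \<longrightarrow> w = 0}"
  have "closed ({s :: 'a \<Rightarrow> real. s x \<in> {0}} \<union> {s. s y \<in> {0}})" for x y
    by (intro closed_Un closed_coordinate) auto
  then have "closed (\<Inter>(x, y)\<in>D. {s :: 'a \<Rightarrow> real. s x \<in> {0}} \<union> {s. s y \<in> {0}})"
    by (intro closed_INT) auto
  moreover have "{s. s extreme_point_of (state_space :: ('a \<Rightarrow> real) set)} =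
    state_space \<inter> (\<Inter>(x, y)\<in>D. {s :: 'a \<Rightarrow> real. s x \<in> {0}} \<union> {s. s y \<in> {0}})"
  proof -
    have "s extreme_point_of state_space \<longleftrightarrow> s \<in> state_space \<and> disjointness_preserving s"
      for s :: "'a \<Rightarrow> real"
      using extreme_state_disjointness_preserving[OF top] disjointness_preserving_extreme[OF top]
      unfolding extreme_point_of_def by blast
    then show ?thesis by (auto simp: D_def disjointness_preserving_def)
  qed
  ultimately show ?thesis using compact_Int_closed[OF compact_state_space[OF top]] by simp
qed

section \<open>Refinement of formal sums\<close>

interpretation oplus: comp_fun_commute "(\<oplus>) :: 'a::emv_algebra \<Rightarrow> 'a \<Rightarrow> 'a"
  by standard (auto simp: oplus_ac)

definition osum :: "'a::emv_algebra multiset \<Rightarrow> 'a"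
  where "osum = fold_mset (\<oplus>) 0"

lemma osum_empty [simp]: "osum {#} = 0"
  and osum_add [simp]: "osum (add_mset x X) = x \<oplus> osum X"
  by (simp_all add: osum_def)

inductive summable_mset :: "'a::emv_algebra multiset \<Rightarrow> bool"
  where summable_mset_empty: "summable_mset {#}"
  | summable_mset_add: "summable_mset X \<Longrightarrow> summable_pair x (osum X) \<Longrightarrow> summable_mset (add_mset x X)"

lemma osum_union [simp]: "osum (X + Y) = osum X \<oplus> osum Y"
  by (induction X) (simp_all add: oplus_assoc)

lemma summable_pair_left_commute:
  fixes x y w :: "'a::emv_algebra"
  assumes "summable_pair y w" "summable_pair x (y \<oplus> w)"
  shows "summable_pair x w" "summable_pair y (x \<oplus> w)"
  using summable_pair_assoc'[of w y x] assms summable_pair_assoc[of x y w] summable_pair_assoc[of y x w]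
    summable_pair_assoc'[of y w x]
  by (simp_all add: oplus_commute summable_pair_commute)

text \<open>The rule that built the multiset may have added another element last;
  \<open>summable_pair_left_commute\<close> exchanges the two. Summability thus does not depend on
  the order of the summands.\<close>

lemma summable_mset_addD:
  "summable_mset (add_mset x X) \<Longrightarrow> summable_mset X \<and> summable_pair x (osum X)"
proof (induction "add_mset x X" arbitrary: X rule: summable_mset.induct)
  case (summable_mset_add Y y)
  show ?case
  proof (cases "x = y")
    case True
    then show ?thesis using summable_mset_add by simp
  next
    case False
    then obtain K where K: "Y = add_mset x K" "X = add_mset y K"
      using summable_mset_add.hyps(4) by (metis add_eq_conv_ex)
    then have IH: "summable_mset K" "summable_pair x (osum K)"
      using summable_mset_add.hyps(2) by auto
    have "summable_pair y (osum K)" "summable_pair x (y \<oplus> osum K)"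
      using summable_pair_left_commute[OF IH(2), of y] summable_mset_add.hyps(3) K(1) by simp_all
    then show ?thesis using IH K(2) summable_mset.summable_mset_add by simp
  qed
qed simp

lemma summable_mset_add_iff:
  "summable_mset (add_mset x X) \<longleftrightarrow> summable_mset X \<and> summable_pair x (osum X)"
  using summable_mset_addD summable_mset_add by blast

lemma summable_mset_union_iff:
  "summable_mset (X + Y) \<longleftrightarrow> summable_mset X \<and> summable_mset Y \<and> summable_pair (osum X) (osum Y)"
proof (induction X)
  case empty
  then show ?case by (simp add: summable_mset_empty)
next
  case (add x X)
  show ?case
    using summable_pair_assoc[of x "osum X" "osum Y"] summable_pair_assoc'[of "osum X" "osum Y" x]
    by (auto simp: summable_mset_add_iff add)
qed

inductive splits_into :: "'a::emv_algebra multiset \<Rightarrow> 'a multiset \<Rightarrow> bool"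
  where splits_into_empty: "splits_into {#} {#}"
  | splits_into_add: "splits_into X Z \<Longrightarrow> summable_mset Y \<Longrightarrow> osum Y = x \<Longrightarrow> splits_into (add_mset x X) (Y + Z)"

lemma splits_into_emptyD: "splits_into {#} Z \<Longrightarrow> Z = {#}"
  by (erule splits_into.cases) auto

lemma splits_into_addD:
  "splits_into (add_mset x X) W \<Longrightarrow> \<exists>Y Z. W = Y + Z \<and> splits_into X Z \<and> summable_mset Y \<and> osum Y = x"
proof (induction "add_mset x X" W arbitrary: X rule: splits_into.induct)
  case (splits_into_add X' Z Y x')
  show ?case
  proof (cases "x = x'")
    case True
    then show ?thesis using splits_into_add by auto
  next
    case False
    then obtain K where K: "X' = add_mset x K" "X = add_mset x' K"
      using splits_into_add.hyps(5) by (metis add_eq_conv_ex)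
    then obtain Y' Z' where IH: "Z = Y' + Z'" "splits_into K Z'" "summable_mset Y'" "osum Y' = x"
      using splits_into_add.hyps(2) by blast
    then have "splits_into X (Y + Z')"
      using splits_into.splits_into_add[OF IH(2) splits_into_add.hyps(3,4)] K by simp
    then show ?thesis using IH by (intro exI[of _ Y'] exI[of _ "Y + Z'"]) (simp add: ac_simps)
  qed
qed simp

lemma splits_into_union: "splits_into X Z \<Longrightarrow> splits_into Y W \<Longrightarrow> splits_into (X + Y) (Z + W)"
  by (induction rule: splits_into.induct) (auto simp: add.assoc intro: splits_into_add)

lemma splits_into_unionD:
  "splits_into (X + Y) W \<Longrightarrow> \<exists>Z Z'. W = Z + Z' \<and> splits_into X Z \<and> splits_into Y Z'"
proof (induction X arbitrary: W)
  case empty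
  then show ?case using splits_into_empty by (intro exI[of _ "{#}"] exI[of _ W]) simp
next
  case (add x X)
  then obtain Y' Z where Z: "W = Y' + Z" "splits_into (X + Y) Z" "summable_mset Y'" "osum Y' = x"
    using splits_into_addD[of x "X + Y" W] by auto
  with add.IH obtain Z1 Z2 where "Z = Z1 + Z2" "splits_into X Z1" "splits_into Y Z2" by blast
  then show ?case using Z splits_into_add by (intro exI[of _ "Y' + Z1"] exI[of _ Z2]) (simp add: add.assoc)
qed

lemma splits_into_single: "summable_mset Y \<Longrightarrow> splits_into {#osum Y#} Y"
  using splits_into_add[OF splits_into_empty] by fastforce

lemma splits_into_singleD: "splits_into {#x#} Y \<Longrightarrow> summable_mset Y \<and> osum Y = x"
  using splits_into_addD[of x "{#}" Y] splits_into_emptyD by fastforce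

lemma summable_mset_single [simp]: "summable_mset {#x#}"
  by (simp add: summable_mset_add_iff summable_mset_empty)

lemma splits_into_refl: "splits_into X X"
proof (induction X)
  case (add x X)
  then show ?case using splits_into_add[of X X "{#x#}" x] by simp
qed (rule splits_into_empty)

lemma splits_into_summable: "splits_into Z T \<Longrightarrow> summable_mset Z \<Longrightarrow> summable_mset T \<and> osum T = osum Z"
  by (induction rule: splits_into.induct) (auto simp: summable_mset_add_iff summable_mset_union_iff)

lemma splits_into_trans: "splits_into X Z \<Longrightarrow> splits_into Z T \<Longrightarrow> splits_into X T"
proof (induction arbitrary: T rule: splits_into.induct)
  case splits_into_empty
  then show ?case by (auto dest: splits_into_emptyD intro: splits_into.splits_into_empty)
next
  case (splits_into_add X Z Y x)
  then obtain T1 T2 where T: "T = T1 + T2" "splits_into Y T1" "splits_into Z T2"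
    using splits_into_unionD by blast
  then show ?case
    using splits_into_add splits_into.splits_into_add[of X T2 T1 x] splits_into_summable[OF T(2)] by simp
qed

lemma splits_into_zero: "osum Z = 0 \<Longrightarrow> splits_into Z {#}"
proof (induction Z)
  case (add z Z)
  then have "z = 0" "osum Z = 0" using oplus_eq_zero[of z "osum Z"] by simp_all
  then show ?case using add.IH splits_into_add[of Z "{#}" "{#}" 0] summable_mset_empty by simp
qed (rule splits_into_empty)

text \<open>The Riesz table for z and the sum of the rest against x and y splits z into two pieces
  and leaves the rest to be split by the induction hypothesis.\<close>

lemma summable_mset_split:
  fixes x y :: "'a::emv_algebra"
  shows "summable_mset Z \<Longrightarrow> osum Z = x \<oplus> y \<Longrightarrow> summable_pair x y \<Longrightarrow>
    \<exists>A B. splits_into Z (A + B) \<and> summable_mset A \<and> osum A = x \<and> summable_mset B \<and> osum B = y"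
proof (induction arbitrary: x y rule: summable_mset.induct)
  case summable_mset_empty
  then have "x = 0" "y = 0" using oplus_eq_zero[of x y] by simp_all
  then show ?case using splits_into_empty summable_mset.summable_mset_empty
    by (intro exI[of _ "{#}"]) simp
next
  case (summable_mset_add Z z)
  have "z \<oplus> osum Z = x \<oplus> y" using summable_mset_add.prems(1) by simp
  then obtain a b c d where r: "summable_pair a b" "z = a \<oplus> b" "summable_pair c d" "osum Z = c \<oplus> d"
      "summable_pair a c" "x = a \<oplus> c" "summable_pair b d" "y = b \<oplus> d"
      "\<forall>w. w \<sqsubseteq> b \<longrightarrow> w \<sqsubseteq> c \<longrightarrow> w = 0"
    by (rule disjoint_refinement[OF summable_mset_add.hyps(2) summable_mset_add.prems(2)])
  obtain A B where AB: "splits_into Z (A + B)" "summable_mset A" "osum A = c" "summable_mset B" "osum B = d"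
    using summable_mset_add.IH[OF r(4,3)] by blast
  have "splits_into (add_mset z Z) ({#a, b#} + (A + B))"
    using r(1,2) AB(1) by (intro splits_into_add) (simp_all add: summable_mset_add_iff summable_mset_empty)
  then have "splits_into (add_mset z Z) (add_mset a A + add_mset b B)"
    by (simp add: add_mset_commute)
  then show ?case
    using AB r by (intro exI[of _ "add_mset a A"] exI[of _ "add_mset b B"]) (simp add: summable_mset_add_iff)
qed

text \<open>Split Z' according to the sum of z and the rest: the first part refines z directly, the
  second has a common refinement with the rest by induction.\<close>

lemma common_refinement:
  "summable_mset Z \<Longrightarrow> summable_mset Z' \<Longrightarrow> osum Z = osum Z' \<Longrightarrow> \<exists>T. splits_into Z T \<and> splits_into Z' T"
proof (induction arbitrary: Z' rule: summable_mset.induct)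
  case summable_mset_empty
  then show ?case using splits_into_zero[of Z'] splits_into_empty by auto
next
  case (summable_mset_add Z z)
  obtain A B where AB: "splits_into Z' (A + B)" "summable_mset A" "osum A = z" "summable_mset B" "osum B = osum Z"
    using summable_mset_split[of Z' z "osum Z"] summable_mset_add by auto
  obtain T where T: "splits_into Z T" "splits_into B T" using summable_mset_add.IH[OF AB(4)] AB(5) by auto
  have "splits_into (add_mset z Z) (A + T)" using splits_into_add[OF T(1) AB(2,3)] .
  moreover have "splits_into Z' (A + T)"
    using splits_into_trans[OF AB(1)] splits_into_union[OF splits_into_refl T(2)] by blast
  ultimately show ?case by blast
qed

text \<open>Entry by entry, the two refinements have equal sums and hence a common refinement. This
  makes the preorder below transitive.\<close>

lemma splits_into_confluent: "splits_into X Z \<Longrightarrow> splits_into X Z' \<Longrightarrow> \<exists>T. splits_into Z T \<and> splits_into Z' T"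
proof (induction arbitrary: Z' rule: splits_into.induct)
  case splits_into_empty
  then show ?case using splits_into_refl splits_into_emptyD by blast
next
  case (splits_into_add X Z Y x)
  then obtain Y' W where W: "Z' = Y' + W" "splits_into X W" "summable_mset Y'" "osum Y' = x"
    using splits_into_addD by blast
  obtain T where "splits_into Z T" "splits_into W T" using splits_into_add.IH[OF W(2)] by blast
  moreover obtain T' where "splits_into Y T'" "splits_into Y' T'"
    using common_refinement[OF splits_into_add.hyps(2) W(3)] splits_into_add.hyps(3) W(4) by auto
  ultimately show ?case using splits_into_union W(1) by blast
qed

text \<open>The order of the positive cone of the universal group of the partial monoid \<open>M\<close>, on
  formal sums.\<close>

definition msum_le :: "'a::emv_algebra multiset \<Rightarrow> 'a multiset \<Rightarrow> bool"
  where "msum_le X Y \<longleftrightarrow> (\<exists>Z W. splits_into X Z \<and> splits_into Y (Z + W))"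

section \<open>The preorder of formal sums and its cancellation law\<close>

lemma msum_le_if_splits_into: "splits_into X Y \<Longrightarrow> msum_le X Y" "splits_into X Y \<Longrightarrow> msum_le Y X"
  unfolding msum_le_def using splits_into_refl by (metis add_0_right)+

lemma msum_le_refl: "msum_le X X"
  using msum_le_if_splits_into splits_into_refl by blast

lemma msum_le_empty: "msum_le {#} X"
  unfolding msum_le_def using splits_into_refl splits_into_empty by (metis add_0_left)

lemma msum_le_union:
  assumes "msum_le X Y" "msum_le X' Y'"
  shows "msum_le (X + X') (Y + Y')"
proof -
  obtain Z W Z' W' where "splits_into X Z" "splits_into Y (Z + W)" "splits_into X' Z'" "splits_into Y' (Z' + W')"
    using assms unfolding msum_le_def by blast
  then have "splits_into (X + X') (Z + Z')" "splits_into (Y + Y') ((Z + Z') + (W + W'))"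
    using splits_into_union by (metis, metis union_mset_add_mset_left add.assoc add.left_commute)
  then show ?thesis unfolding msum_le_def by blast
qed

lemma msum_le_trans:
  assumes "msum_le X Y" "msum_le Y V"
  shows "msum_le X V"
proof -
  obtain Z W Z' W' where zw: "splits_into X Z" "splits_into Y (Z + W)" "splits_into Y Z'" "splits_into V (Z' + W')"
    using assms unfolding msum_le_def by blast
  obtain T where T: "splits_into (Z + W) T" "splits_into Z' T" using splits_into_confluent[OF zw(2,3)] by blast
  obtain T1 T2 where T12: "T = T1 + T2" "splits_into Z T1" "splits_into W T2" using splits_into_unionD[OF T(1)] by blast
  have "splits_into V (T1 + (T2 + W'))"
    using splits_into_trans[OF zw(4)] splits_into_union[OF T(2) splits_into_refl[of W']] T12(1) by (metis add.assoc)
  then show ?thesis unfolding msum_le_def using splits_into_trans[OF zw(1) T12(2)] by blast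
qed

lemma msum_le_single:
  assumes "x \<sqsubseteq> y"
  shows "msum_le {#x#} {#y#}"
proof -
  obtain z where z: "summable_pair x z" "x \<oplus> z = y" using assms unfolding sum_le_def by blast
  then have "splits_into {#y#} ({#x#} + {#z#})"
    using splits_into_single[of "{#x, z#}"]
    by (simp add: summable_mset_add_iff summable_mset_empty add_mset_commute)
  then show ?thesis unfolding msum_le_def using splits_into_refl by blast
qed

text \<open>The two copies of c may have been split differently, into A and B. Without their common
  part these become U and V, which have equal sums but no common entry, so U occurs inside the
  refinement of Y and V inside that of X together with the surplus W. Replacing U and V by a common
  refinement T removes the discrepancy.\<close>

lemma msum_le_cancel:
  assumes "msum_le (add_mset c X) (add_mset c Y)"
  shows "msum_le X Y"
proof -
  obtain Z W where ZW: "splits_into (add_mset c X) Z" "splits_into (add_mset c Y) (Z + W)"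
    using assms unfolding msum_le_def by blast
  obtain A Zx where A: "Z = A + Zx" "splits_into X Zx" "summable_mset A" "osum A = c"
    using splits_into_addD[OF ZW(1)] by blast
  obtain B Zy where B: "Z + W = B + Zy" "splits_into Y Zy" "summable_mset B" "osum B = c"
    using splits_into_addD[OF ZW(2)] by blast
  define K where "K = A \<inter># B"
  define U where "U = A - K"
  define V where "V = B - K"
  have AB: "A = K + U" "B = K + V"
    by (auto intro!: multiset_eqI simp: K_def U_def V_def)
  have "U \<inter># V = {#}"
    by (rule multiset_eqI) (simp add: U_def V_def K_def)
  have split: "summable_mset K" "summable_mset U" "summable_mset V"
    "summable_pair (osum K) (osum U)" "summable_pair (osum K) (osum V)"
    using A(3) B(3) AB by (simp_all add: summable_mset_union_iff)
  have "osum U \<oplus> osum K = osum V \<oplus> osum K"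
    using A(4) B(4) AB by (simp add: oplus_commute)
  then have "osum U = osum V"
    using split(4,5) summable_pair_cancel summable_pair_commute by blast
  then obtain T where T: "splits_into U T" "splits_into V T" using common_refinement split by blast
  have eq: "U + (Zx + W) = V + Zy" using A(1) B(1) AB by (simp add: add.assoc)
  have "U \<subseteq># Zy"
  proof (rule mset_subset_eqI)
    fix a
    have "count U a = 0 \<or> count V a = 0"
      using \<open>U \<inter># V = {#}\<close> by (metis count_empty count_inter_mset min_def)
    moreover have "count U a + (count Zx a + count W a) = count V a + count Zy a"
      using eq by (metis count_union)
    ultimately show "count U a \<le> count Zy a" by auto
  qed
  then obtain R where R: "Zy = U + R" using mset_subset_eq_exists_conv by blast
  then have eq': "Zx + W = V + R" using eq by (simp add: add.left_commute)
  have "splits_into (Zx + W) (T + R)" unfolding eq' using splits_into_union[OF T(2) splits_into_refl] .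
  then obtain T1 T2 where T12: "T + R = T1 + T2" "splits_into Zx T1" using splits_into_unionD by blast
  have "splits_into Y (T1 + T2)"
    using splits_into_trans[OF B(2)] splits_into_union[OF T(1) splits_into_refl[of R]] R T12(1) by simp
  then show ?thesis
    unfolding msum_le_def using splits_into_trans[OF A(2) T12(2)] by blast
qed

text \<open>Cancelling n copies leaves c below the empty sum. This is what makes a non-zero c usable
  as a strict order unit.\<close>

lemma msum_le_replicate:
  assumes "msum_le (replicate_mset (Suc n) c) (replicate_mset n c)"
  shows "c = 0"
  using assms
proof (induction n)
  case 0
  then obtain Z where Z: "splits_into {#c#} Z" "splits_into {#} Z"
    unfolding msum_le_def using splits_into_emptyD by fastforce
  then show ?case using splits_into_singleD[OF Z(1)] splits_into_emptyD[OF Z(2)] by simp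
next
  case (Suc n)
  then show ?case using msum_le_cancel[of c "replicate_mset (Suc n) c" "replicate_mset n c"] by simp
qed

section \<open>Minimal sublinear functionals\<close>

text \<open>A minimal sublinear functional \<open>p\<close> is additive, as \<open>X \<mapsto> inf\<^sub>n (p (X + n Y) - n p Y)\<close> is a sublinear functional below \<open>p\<close>.\<close>

locale preordered_mset =
  fixes le :: "'b multiset \<Rightarrow> 'b multiset \<Rightarrow> bool" and u :: "'b multiset"
  assumes le_refl: "le X X"
    and le_trans: "le X Y \<Longrightarrow> le Y Z \<Longrightarrow> le X Z"
    and le_add: "le X Y \<Longrightarrow> le (X + Z) (Y + Z)"
    and le_empty: "le {#} X"
    and order_unit: "\<exists>n. le X (repeat_mset n u)"
    and unit_strict: "\<not> le (repeat_mset (Suc n) u) (repeat_mset n u)"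
begin

lemma le_add2: "le X Y \<Longrightarrow> le X' Y' \<Longrightarrow> le (X + X') (Y + Y')"
  using le_add[of X Y X'] le_add[of X' Y' Y] le_trans by (simp add: add.commute)

lemma le_repeat: "le X Y \<Longrightarrow> le (repeat_mset n X) (repeat_mset n Y)"
  by (induction n) (simp_all add: le_refl le_add2)

lemma le_union: "le Y (X + Y)"
  using le_add[OF le_empty, of Y X] by simp

lemma unit_repeat_le: "le (repeat_mset l u) (repeat_mset k u) \<Longrightarrow> l \<le> k"
proof (rule ccontr)
  assume le: "le (repeat_mset l u) (repeat_mset k u)" and "\<not> l \<le> k"
  then have "repeat_mset l u = repeat_mset (l - Suc k) u + repeat_mset (Suc k) u"
    by (metis Suc_leI add.commute le_add_diff_inverse not_le repeat_mset_distrib)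
  then have "le (repeat_mset (Suc k) u) (repeat_mset l u)" by (simp only: le_union)
  then show False using le le_trans unit_strict by blast
qed

text \<open>The last clause contains the normalisation \<open>p u = 1\<close> and has a form that
  survives infima. Homogeneity is restricted to the multiples that exist for multisets.\<close>

definition sublinear :: "('b multiset \<Rightarrow> real) \<Rightarrow> bool"
  where "sublinear p \<longleftrightarrow> (\<forall>X Y. p (X + Y) \<le> p X + p Y) \<and>
    (\<forall>n X. p (repeat_mset n X) = real n * p X) \<and>
    (\<forall>X Y. le X Y \<longrightarrow> p X \<le> p Y) \<and> (\<forall>X. p (X + u) = p X + 1)"

lemma sublinearD:
  assumes "sublinear p"
  shows "p (X + Y) \<le> p X + p Y" "p (repeat_mset n X) = real n * p X" "le X Y \<Longrightarrow> p X \<le> p Y"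
    "p (X + u) = p X + 1" "p {#} = 0" "0 \<le> p X"
proof -
  show "p (X + Y) \<le> p X + p Y" "p (repeat_mset n X) = real n * p X" "le X Y \<Longrightarrow> p X \<le> p Y"
    "p (X + u) = p X + 1"
    using assms unfolding sublinear_def by blast+
  have "p (repeat_mset 0 X) = real 0 * p X" using assms unfolding sublinear_def by blast
  then show "p {#} = 0" by simp
  then show "0 \<le> p X" using assms le_empty[of X] unfolding sublinear_def by metis
qed

text \<open>Serves three infima: the gauge of the order unit, the lower bound of a chain, and the
  functional that tests minimality. Each closure condition on the sets \<open>R X\<close> passes one
  clause of sublinearity to their infima.\<close>

lemma sublinear_InfI:
  fixes R :: "'b multiset \<Rightarrow> real set"
  assumes ne: "\<And>X. R X \<noteq> {}" and nonneg: "\<And>X r. r \<in> R X \<Longrightarrow> 0 \<le> r"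
    and add: "\<And>X Y r s. r \<in> R X \<Longrightarrow> s \<in> R Y \<Longrightarrow> \<exists>v\<in>R (X + Y). v \<le> r + s"
    and zero: "0 \<in> R {#}"
    and scale: "\<And>n X r. r \<in> R X \<Longrightarrow> 0 < n \<Longrightarrow> \<exists>v\<in>R (repeat_mset n X). v \<le> real n * r"
    and unscale: "\<And>n X r. r \<in> R (repeat_mset n X) \<Longrightarrow> 0 < n \<Longrightarrow> \<exists>v\<in>R X. real n * v \<le> r"
    and mono: "\<And>X Y r. le X Y \<Longrightarrow> r \<in> R Y \<Longrightarrow> \<exists>v\<in>R X. v \<le> r"
    and unit: "\<And>X r. r \<in> R X \<Longrightarrow> \<exists>v\<in>R (X + u). v \<le> r + 1"
    and ununit: "\<And>X r. r \<in> R (X + u) \<Longrightarrow> \<exists>v\<in>R X. v + 1 \<le> r"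
  shows "sublinear (\<lambda>X. Inf (R X))"
proof -
  have lower: "Inf (R X) \<le> r" if "v \<in> R X" "v \<le> r" for X v r
    using cInf_lower[OF that(1)] nonneg that(2) by (meson bdd_belowI order_trans)
  have greatest: "b \<le> Inf (R X)" if "\<And>r. r \<in> R X \<Longrightarrow> b \<le> r" for X b
    using cInf_greatest[OF ne] that by blast
  show ?thesis
    unfolding sublinear_def
  proof (intro conjI allI impI)
    fix X Y
    have *: "Inf (R (X + Y)) - s \<le> Inf (R X)" if s: "s \<in> R Y" for s
    proof (rule greatest)
      fix r assume "r \<in> R X"
      then obtain v where "v \<in> R (X + Y)" "v \<le> r + s" using add s by blast
      then have "Inf (R (X + Y)) \<le> r + s" by (rule lower)
      then show "Inf (R (X + Y)) - s \<le> r" by simp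
    qed
    have "Inf (R (X + Y)) - Inf (R X) \<le> Inf (R Y)"
    proof (rule greatest)
      fix s assume "s \<in> R Y"
      from *[OF this] show "Inf (R (X + Y)) - Inf (R X) \<le> s" by simp
    qed
    then show "Inf (R (X + Y)) \<le> Inf (R X) + Inf (R Y)" by simp
  next
    fix X Y assume le: "le X Y"
    show "Inf (R X) \<le> Inf (R Y)"
      using mono[OF le] lower by (blast intro: greatest)
  next
    fix X
    show "Inf (R (X + u)) = Inf (R X) + 1"
    proof (rule antisym)
      have "Inf (R (X + u)) - 1 \<le> Inf (R X)"
      proof (rule greatest)
        fix r assume "r \<in> R X"
        then obtain v where "v \<in> R (X + u)" "v \<le> r + 1" using unit by blast
        from lower[OF this] show "Inf (R (X + u)) - 1 \<le> r" by simp
      qed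
      then show "Inf (R (X + u)) \<le> Inf (R X) + 1" by simp
      show "Inf (R X) + 1 \<le> Inf (R (X + u))"
      proof (rule greatest)
        fix r assume "r \<in> R (X + u)"
        then obtain v where "v \<in> R X" "v + 1 \<le> r" using ununit by blast
        then show "Inf (R X) + 1 \<le> r" using lower[of v X v] by simp
      qed
    qed
  next
    fix n X
    show "Inf (R (repeat_mset n X)) = real n * Inf (R X)"
    proof (cases "n = 0")
      case True
      have "Inf (R {#}) = 0" by (rule antisym[OF lower[OF zero] greatest]) (use nonneg in auto)
      then show ?thesis using True by simp
    next
      case False
      then have n: "0 < n" "0 < real n" by auto
      show ?thesis
      proof (rule antisym)
        have "Inf (R (repeat_mset n X)) / real n \<le> Inf (R X)"
        proof (rule greatest)
          fix r assume "r \<in> R X"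
          then obtain v where "v \<in> R (repeat_mset n X)" "v \<le> real n * r" using scale n by blast
          from lower[OF this] show "Inf (R (repeat_mset n X)) / real n \<le> r"
            using n by (simp add: field_simps)
        qed
        then show "Inf (R (repeat_mset n X)) \<le> real n * Inf (R X)"
          using n by (simp add: field_simps)
        show "real n * Inf (R X) \<le> Inf (R (repeat_mset n X))"
        proof (rule greatest)
          fix r assume "r \<in> R (repeat_mset n X)"
          then obtain v where v: "v \<in> R X" "real n * v \<le> r" using unscale n by blast
          have "real n * Inf (R X) \<le> real n * v"
            using lower[OF v(1) order_refl] n by (intro mult_left_mono) auto
          then show "real n * Inf (R X) \<le> r" using v(2) by simp
        qed
      qed
    qed
  qed
qed

lemma sublinear_exists: "\<exists>p. sublinear p"
proof -
  \<comment> \<open>The gauge of u. The copies counted by l stand on the left because the preorder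
    is not assumed to be cancellative: a bound for \<open>X + u\<close> yields one for X only by
    moving u into this term. By \<open>unit_repeat_le\<close> the quotients are
    non-negative.\<close>
  define R where "R X = {(real k - real l) / real n | n k l.
    0 < n \<and> le (repeat_mset n X + repeat_mset l u) (repeat_mset k u)}" for X
  have RI: "r \<in> R X"
    if "0 < n" "le (repeat_mset n X + repeat_mset l u) (repeat_mset k u)"
      "r = (real k - real l) / real n" for r n k l X
    using that unfolding R_def by blast
  have RE: "\<exists>n k l. 0 < n \<and> le (repeat_mset n X + repeat_mset l u) (repeat_mset k u) \<and>
      r = (real k - real l) / real n" if "r \<in> R X" for r X
    using that unfolding R_def by blast
  have scale: "le (repeat_mset (m * n) X + repeat_mset (m * l) u) (repeat_mset (m * k) u)"
    if "le (repeat_mset n X + repeat_mset l u) (repeat_mset k u)" for m n k l X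
    using le_repeat[OF that, of m] by simp
  have "sublinear (\<lambda>X. Inf (R X))"
  proof (rule sublinear_InfI)
    fix X
    obtain n where "le X (repeat_mset n u)" using order_unit by blast
    then show "R X \<noteq> {}" using RI[of 1 X 0 n] by auto
  next
    fix X r assume "r \<in> R X"
    then obtain n k l where r: "0 < n" "le (repeat_mset n X + repeat_mset l u) (repeat_mset k u)"
      "r = (real k - real l) / real n" using RE by blast
    then have "l \<le> k" using le_trans[OF le_union] unit_repeat_le by blast
    then show "0 \<le> r" using r by simp
  next
    fix X Y r s assume "r \<in> R X" "s \<in> R Y"
    then obtain n k l n' k' l' where
      r: "0 < n" "le (repeat_mset n X + repeat_mset l u) (repeat_mset k u)"
        "r = (real k - real l) / real n" and
      s: "0 < n'" "le (repeat_mset n' Y + repeat_mset l' u) (repeat_mset k' u)"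
        "s = (real k' - real l') / real n'" using RE by metis
    have "le (repeat_mset (n' * n) X + repeat_mset (n' * l) u + (repeat_mset (n * n') Y + repeat_mset (n * l') u))
      (repeat_mset (n' * k) u + repeat_mset (n * k') u)"
      by (intro le_add2 scale r s)
    then have "le (repeat_mset (n * n') (X + Y) + repeat_mset (n' * l + n * l') u)
      (repeat_mset (n' * k + n * k') u)"
      by (simp add: repeat_mset_distrib ac_simps)
    moreover have "r + s = (real (n' * k + n * k') - real (n' * l + n * l')) / real (n * n')"
    proof -
      have "real k = r * real n + real l" "real k' = s * real n' + real l'"
        using r(1,3) s(1,3) by simp_all
      then show ?thesis using r(1) s(1) by (simp add: field_simps)
    qed
    ultimately have "r + s \<in> R (X + Y)" using r(1) s(1) by (intro RI[of "n * n'"]) auto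
    then show "\<exists>v\<in>R (X + Y). v \<le> r + s" by blast
  next
    show "0 \<in> R {#}" using RI[of 1 "{#}" 0 0 0] le_refl by simp
  next
    fix m :: nat and X r assume "r \<in> R X" "0 < m"
    then obtain n k l where r: "0 < n" "le (repeat_mset n X + repeat_mset l u) (repeat_mset k u)"
      "r = (real k - real l) / real n" using RE by blast
    have "real m * r \<in> R (repeat_mset m X)"
      using scale[OF r(2), of m] r
      by (intro RI[of n _ "m * l" "m * k"]) (auto simp: mult.commute right_diff_distrib)
    then show "\<exists>v\<in>R (repeat_mset m X). v \<le> real m * r" by blast
  next
    fix m :: nat and X r assume "r \<in> R (repeat_mset m X)" and m: "0 < m"
    then obtain n k l where r: "0 < n" "le (repeat_mset n (repeat_mset m X) + repeat_mset l u) (repeat_mset k u)"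
      "r = (real k - real l) / real n" using RE by blast
    then have "r / real m \<in> R X" using m by (intro RI[of "n * m" _ l k]) auto
    then show "\<exists>v\<in>R X. real m * v \<le> r" using m by (intro bexI[of _ "r / real m"]) auto
  next
    fix X Y r assume le: "le X Y" and "r \<in> R Y"
    then obtain n k l where r: "0 < n" "le (repeat_mset n Y + repeat_mset l u) (repeat_mset k u)"
      "r = (real k - real l) / real n" using RE by blast
    then have "r \<in> R X" using le_trans[OF le_add[OF le_repeat[OF le]]] by (intro RI)
    then show "\<exists>v\<in>R X. v \<le> r" by blast
  next
    fix X r assume "r \<in> R X"
    then obtain n k l where r: "0 < n" "le (repeat_mset n X + repeat_mset l u) (repeat_mset k u)"
      "r = (real k - real l) / real n" using RE by blast
    have "le (repeat_mset n (X + u) + repeat_mset l u) (repeat_mset (k + n) u)"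
      using le_add[OF r(2), of "repeat_mset n u"] by (simp add: repeat_mset_distrib ac_simps)
    then have "r + 1 \<in> R (X + u)" using r(1,3) by (intro RI) (auto simp: field_simps)
    then show "\<exists>v\<in>R (X + u). v \<le> r + 1" by blast
  next
    fix X r assume "r \<in> R (X + u)"
    then obtain n k l where r: "0 < n" "le (repeat_mset n (X + u) + repeat_mset l u) (repeat_mset k u)"
      "r = (real k - real l) / real n" using RE by blast
    have "le (repeat_mset n X + repeat_mset (n + l) u) (repeat_mset k u)"
      using r(2) by (simp add: repeat_mset_distrib ac_simps)
    then have "r - 1 \<in> R X" using r(1,3) by (intro RI) (auto simp: field_simps)
    then show "\<exists>v\<in>R X. v + 1 \<le> r" by (intro bexI[of _ "r - 1"]) auto
  qed
  then show ?thesis by blast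
qed

lemma minimal_sublinear:
  obtains p where "sublinear p" "\<forall>q. sublinear q \<longrightarrow> (\<forall>X. q X \<le> p X) \<longrightarrow> q = p"
proof -
  \<comment> \<open>The pointwise order reversed, so that a maximal element in Zorn's lemma is a
    minimal functional.\<close>
  define P :: "('b multiset \<Rightarrow> real) \<Rightarrow> ('b multiset \<Rightarrow> real) \<Rightarrow> bool"
    where "P p q \<longleftrightarrow> (\<forall>X. q X \<le> p X)" for p q
  have "\<exists>m\<in>Collect sublinear. \<forall>a\<in>Collect sublinear. P m a \<longrightarrow> a = m"
  proof (rule predicate_Zorn)
    show "partial_order_on (Collect sublinear) (relation_of P (Collect sublinear))"
      by (rule partial_order_on_relation_ofI) (auto simp: P_def fun_eq_iff intro: order_trans antisym)
  next
    fix C assume "C \<in> Chains (relation_of P (Collect sublinear))"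
    then have C: "\<And>p. p \<in> C \<Longrightarrow> sublinear p" "\<And>p q. p \<in> C \<Longrightarrow> q \<in> C \<Longrightarrow> P p q \<or> P q p"
      unfolding Chains_def relation_of_def by blast+
    show "\<exists>q\<in>Collect sublinear. \<forall>p\<in>C. P p q"
    proof (cases "C = {}")
      case True
      then show ?thesis using sublinear_exists by blast
    next
      case False
      define R where "R X = (\<lambda>p. p X) ` C" for X
      have "sublinear (\<lambda>X. Inf (R X))"
      proof (rule sublinear_InfI)
        show "\<exists>v\<in>R (X + Y). v \<le> r + s" if rs: "r \<in> R X" "s \<in> R Y" for X Y r s
        proof -
          obtain p q where pq: "p \<in> C" "q \<in> C" "r = p X" "s = q Y" using rs unfolding R_def by blast
          \<comment> \<open>The smaller of the two functionals in the chain serves for both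
            summands.\<close>
          from C(2)[OF pq(1,2)] show ?thesis
          proof
            assume "P p q"
            then have "q (X + Y) \<le> r + s"
              using sublinearD(1)[OF C(1)[OF pq(2)], of X Y] pq unfolding P_def
              by (smt (verit))
            then show ?thesis using pq unfolding R_def by blast
          next
            assume "P q p"
            then have "p (X + Y) \<le> r + s"
              using sublinearD(1)[OF C(1)[OF pq(1)], of X Y] pq unfolding P_def
              by (smt (verit))
            then show ?thesis using pq unfolding R_def by blast
          qed
        qed
        show "0 \<in> R {#}" using False sublinearD(5)[OF C(1)] unfolding R_def by force
      qed (use False C(1) sublinearD in \<open>force simp: R_def\<close>)+
      moreover have "Inf (R X) \<le> p X" if "p \<in> C" for p X
        unfolding R_def using that C(1) sublinearD(6)
        by (intro cInf_lower bdd_belowI[of _ 0]) auto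
      ultimately show ?thesis unfolding P_def by (intro bexI[of _ "\<lambda>X. Inf (R X)"]) auto
    qed
  qed
  then show ?thesis using that unfolding P_def by blast
qed

theorem additive_functional:
  obtains s :: "'b multiset \<Rightarrow> real" where "\<And>X Y. s (X + Y) = s X + s Y"
    "\<And>X Y. le X Y \<Longrightarrow> s X \<le> s Y" "s u = 1"
proof -
  obtain p where p: "sublinear p" "\<forall>q. sublinear q \<longrightarrow> (\<forall>X. q X \<le> p X) \<longrightarrow> q = p"
    by (rule minimal_sublinear)
  note pD = sublinearD[OF p(1)]
  have "p X + p Y \<le> p (X + Y)" for X Y
  proof -
    \<comment> \<open>It decreases in n by subadditivity. The index 0 gives p itself, so the infimum
      lies below p.\<close>
    define g where "g n X = p (X + repeat_mset n Y) - real n * p Y" for n X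
    have g_nonneg: "0 \<le> g n X" for n X
      using pD(3)[OF le_union, of "repeat_mset n Y" X] pD(2)[of n Y] by (simp add: g_def)
    have g_Suc: "g (Suc n) X \<le> g n X" for n X
      using pD(1)[of "X + repeat_mset n Y" Y]
      by (simp add: g_def algebra_simps)
    have g_mono: "g n X \<le> g m X" if "m \<le> n" for m n X
      using lift_Suc_antimono_le[of "\<lambda>n. g n X", OF g_Suc that] .
    have g_scale: "g (k * n) (repeat_mset k X) = real k * g n X" for k n X
      using pD(2)[of k "X + repeat_mset n Y"] by (simp add: g_def algebra_simps)
    define R where "R X = range (\<lambda>n. g n X)" for X
    have "sublinear (\<lambda>X. Inf (R X))"
    proof (rule sublinear_InfI)
      fix X X' r s assume "r \<in> R X" "s \<in> R X'"
      then obtain n m where "r = g n X" "s = g m X'" unfolding R_def by blast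
      then have "g (n + m) (X + X') \<le> r + s"
        using pD(1)[of "X + repeat_mset n Y" "X' + repeat_mset m Y"]
        by (simp add: g_def repeat_mset_distrib algebra_simps)
      then show "\<exists>v\<in>R (X + X'). v \<le> r + s" unfolding R_def by blast
    next
      have "g 0 {#} = 0" using pD(5) by (simp add: g_def)
      then show "0 \<in> R {#}" unfolding R_def by (metis rangeI)
    next
      fix k :: nat and X r assume "r \<in> R X"
      then obtain n where "r = g n X" unfolding R_def by blast
      then have "g (k * n) (repeat_mset k X) \<le> real k * r" by (simp only: g_scale order_refl)
      then show "\<exists>v\<in>R (repeat_mset k X). v \<le> real k * r" unfolding R_def by blast
    next
      fix k :: nat and X r assume "r \<in> R (repeat_mset k X)" "0 < k"
      then obtain n where "r = g n (repeat_mset k X)" unfolding R_def by blast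
      \<comment> \<open>The scaling rule needs an index divisible by k, and raising n to
        \<open>k * n\<close> only lowers the value.\<close>
      moreover have "n \<le> k * n" using \<open>0 < k\<close> by simp
      ultimately have "real k * g n X \<le> r" using g_mono g_scale by metis
      then show "\<exists>v\<in>R X. real k * v \<le> r" unfolding R_def by blast
    next
      fix X X' r assume "le X X'" "r \<in> R X'"
      then obtain n where "r = g n X'" unfolding R_def by blast
      then have "g n X \<le> r" using pD(3)[OF le_add[OF \<open>le X X'\<close>]] by (simp add: g_def)
      then show "\<exists>v\<in>R X. v \<le> r" unfolding R_def by blast
    next
      have g_unit: "g n (X + u) = g n X + 1" for n X
        using pD(4)[of "X + repeat_mset n Y"] by (simp add: g_def ac_simps)
      show "\<exists>v\<in>R (X + u). v \<le> r + 1" if "r \<in> R X" for X r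
        using that g_unit unfolding R_def by force
      show "\<exists>v\<in>R X. v + 1 \<le> r" if "r \<in> R (X + u)" for X r
        using that g_unit unfolding R_def by force
    qed (use g_nonneg in \<open>auto simp: R_def\<close>)
    moreover have lower: "Inf (R X) \<le> g n X" for n X
      unfolding R_def by (intro cInf_lower bdd_belowI[of _ 0]) (use g_nonneg in auto)
    moreover have "Inf (R X) \<le> p X" for X using lower[of X 0] by (simp add: g_def)
    ultimately have "(\<lambda>X. Inf (R X)) = p" using p(2) by blast
    \<comment> \<open>By minimality p is the infimum; the index 1 is superadditivity.\<close>
    then have "p X \<le> g 1 X" using lower by metis
    then show ?thesis by (simp add: g_def)
  qed
  then have "p (X + Y) = p X + p Y" for X Y using pD(1) antisym by blast
  moreover have "p u = 1" using pD(4)[of "{#}"] pD(5) by simp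
  ultimately show ?thesis using that pD(3) by blast
qed

end

section \<open>Existence of states\<close>

lemma sum_ideal_interval:
  fixes c :: "'a::emv_algebra"
  assumes "idempotent c"
  shows "sum_ideal {x. x \<le> c}"
  unfolding sum_ideal_def
  using oplus_closed_interval[OF assms]
  by (auto simp: zero_least dest: sum_le_imp_le intro: order_trans)

lemma additive_on_interval_exists:
  fixes c :: "'a::emv_algebra"
  assumes c: "idempotent c" "c \<noteq> 0"
  obtains f :: "'a \<Rightarrow> real" where "additive_on {x. x \<le> c} f" "\<forall>x\<le>c. 0 \<le> f x" "f c = 1"
proof -
  \<comment> \<open>The locale compares all multisets over the type. Ignoring the entries not below
    c makes c an order unit for all of them.\<close>
  define below where "below = filter_mset (\<lambda>x. x \<le> c)"
  have below_add: "below (X + Y) = below X + below Y" for X Y by (simp add: below_def)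
  have below_unit: "below (repeat_mset n {#c#}) = replicate_mset n c" for n
    by (induction n) (simp_all add: below_def)
  interpret preordered_mset "\<lambda>X Y. msum_le (below X) (below Y)" "{#c#}"
  proof
    fix X Y Z :: "'a multiset"
    show "msum_le (below X) (below X)" by (rule msum_le_refl)
    show "msum_le (below X) (below Z)"
      if "msum_le (below X) (below Y)" "msum_le (below Y) (below Z)"
      using that by (rule msum_le_trans)
    show "msum_le (below (X + Z)) (below (Y + Z))" if "msum_le (below X) (below Y)"
      unfolding below_add using that msum_le_refl by (rule msum_le_union)
    show "msum_le (below {#}) (below X)" by (simp add: below_def msum_le_empty)
    show "\<exists>n. msum_le (below X) (below (repeat_mset n {#c#}))"
    proof (induction X)
      case empty
      show ?case by (simp add: below_def msum_le_empty)
    next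
      case (add x X)
      then obtain n where n: "msum_le (below X) (replicate_mset n c)" unfolding below_unit by blast
      have "msum_le (below {#x#}) {#c#}"
        using msum_le_single[of x c] sum_le_idempotent[OF c(1)] msum_le_empty
        by (cases "x \<le> c") (simp_all add: below_def)
      from msum_le_union[OF this n] have "msum_le (below (add_mset x X)) (replicate_mset (Suc n) c)"
        by (cases "x \<le> c") (simp_all add: below_def)
      then show ?case unfolding below_unit by blast
    qed
    show "\<not> msum_le (below (repeat_mset (Suc n) {#c#})) (below (repeat_mset n {#c#}))" for n
      unfolding below_unit using msum_le_replicate c(2) by blast
  qed
  obtain s :: "'a multiset \<Rightarrow> real" where s: "\<And>X Y. s (X + Y) = s X + s Y"
    "\<And>X Y. msum_le (below X) (below Y) \<Longrightarrow> s X \<le> s Y" "s {#c#} = 1"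
    using additive_functional by blast
  define f where "f x = s {#x#}" for x
  have "additive_on {x. x \<le> c} f"
    unfolding additive_on_def
  proof (intro ballI impI)
    fix x y assume "x \<in> {x. x \<le> c}" "y \<in> {x. x \<le> c}" and xy: "summable_pair x y"
    then have "below {#x, y#} = {#x, y#}" "below {#x \<oplus> y#} = {#x \<oplus> y#}"
      using oplus_closed_interval[OF c(1)] by (simp_all add: below_def)
    moreover have "splits_into {#x \<oplus> y#} {#x, y#}"
      using splits_into_single[of "{#x, y#}"] xy by (simp add: summable_mset_add_iff summable_mset_empty)
    \<comment> \<open>A formal sum and its refinement are below each other.\<close>
    ultimately have "s {#x \<oplus> y#} = s {#x, y#}"
      using s(2) msum_le_if_splits_into antisym by metis
    also have "\<dots> = f x + f y" using s(1)[of "{#x#}" "{#y#}"] by (simp add: f_def add_mset_commute)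
    finally show "f (x \<oplus> y) = f x + f y" by (simp add: f_def)
  qed
  moreover have "0 \<le> f x" for x
  proof -
    have "s {#} = 0" using s(1)[of "{#}" "{#}"] by simp
    moreover have "s {#} \<le> s {#x#}"
      by (rule s(2)) (simp only: below_def filter_empty_mset msum_le_empty)
    ultimately show ?thesis by (simp add: f_def)
  qed
  ultimately show ?thesis using that s(3) by (simp add: f_def)
qed

text \<open>c is b - a. It is disjoint from a because an idempotent absorbs its parts:
  \<open>w \<oplus> a = a\<close> with w summable to a forces w = 0. The difference e of
  \<open>c \<oplus> c\<close> and c is a part of c, and also of a, since b contains c and e without
  overflow. So e = 0 and c is idempotent.\<close>

lemma idempotent_complement:
  fixes a b :: "'a::emv_algebra"
  assumes a: "idempotent a" and b: "idempotent b" "a \<le> b" "a \<noteq> b"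
  obtains c where "idempotent c" "c \<noteq> 0" "\<And>w. w \<le> c \<Longrightarrow> w \<sqsubseteq> a \<Longrightarrow> w = 0"
proof -
  obtain c where c: "summable_pair a c" "a \<oplus> c = b"
    using b sum_le_idempotent unfolding sum_le_def by blast
  have disj: "w = 0" if w: "w \<sqsubseteq> c" "w \<sqsubseteq> a" for w
  proof -
    have "summable_pair w a" using summable_pair_mono[OF c(1) sum_le_refl w(1)] summable_pair_commute by blast
    moreover have "w \<oplus> a = 0 \<oplus> a" using idempotent_absorb[OF a sum_le_imp_le[OF w(2)]] by simp
    ultimately show ?thesis using summable_pair_cancel[of w a 0] by simp
  qed
  have cb: "c \<le> b" using sum_le_imp_le[OF sum_le_oplus(2)[OF c(1)]] c(2) by simp
  interpret mv_algebra "{0..b}" "(\<oplus>)" "lam b" 0 b by (rule mv_interval[OF b(1)])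
  define d where "d = c \<oplus> c"
  have d: "d \<le> b" unfolding d_def by (rule oplus_closed_interval[OF b(1) cb cb])
  have in_b: "c \<in> {0..b}" "d \<in> {0..b}" using cb d by (auto simp: zero_least)
  define e where "e = lam b (lam b d \<oplus> c)"
  have "lam b c \<oplus> d = b" unfolding d_def by (rule neg_add_unit_of_add[OF in_b(1,1)])
  note diff = difference[OF in_b this, folded e_def]
  have eb: "e \<le> b" unfolding e_def by (intro lam_bound oplus_closed_interval b cb d)
  have ce: "summable_pair c e" using diff(1) summable_pair_iff[OF b(1) cb eb] by simp
  have "lam b e = lam b d \<oplus> c"
    unfolding e_def by (rule neg_neg) (intro add_simps in_b)
  then have "lam b e \<oplus> c = lam b d \<oplus> d" by (simp add: d_def oplus_assoc)
  then have "e \<sqsubseteq> c" using sum_le_iff_lam[OF b(1) eb cb] neg_add_self[OF in_b(2)] by simp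
  moreover have "e \<sqsubseteq> a"
  proof -
    obtain w where w: "summable_pair d w" "d \<oplus> w = b"
      using d sum_le_idempotent[OF b(1)] unfolding sum_le_def by blast
    have ew: "summable_pair e w" "summable_pair c (e \<oplus> w)"
      using summable_pair_assoc[OF ce] w diff(2) by simp_all
    have "e \<oplus> w = a"
    proof (rule summable_pair_cancel)
      show "summable_pair (e \<oplus> w) c" "summable_pair a c"
        using ew(2) c(1) summable_pair_commute by blast+
      show "e \<oplus> w \<oplus> c = a \<oplus> c" using w(2) diff(2) c(2) by (metis oplus_ac)
    qed
    then show ?thesis using sum_le_oplus(1)[OF ew(1)] by simp
  qed
  ultimately have "e = 0" by (rule disj)
  then have idem: "idempotent c" using diff(2) by (simp add: idempotent_def d_def)
  moreover have "c \<noteq> 0" using c(2) b(3) by auto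
  ultimately show ?thesis using that disj sum_le_idempotent[OF idem] by blast
qed

text \<open>The supremum over the part of [0,c] below an element extends an additive f from [0,c] to
  M. Its value at a is 0, since only 0 is below both c and a.\<close>

lemma state_vanishing_on_idempotent:
  fixes a x :: "'a::emv_algebra"
  assumes a: "idempotent a" and x: "\<not> x \<le> a"
  shows "\<exists>s\<in>state_space. s a = 0"
proof -
  obtain b where b: "idempotent b" "a \<le> b" "x \<le> b" by (rule idempotent_bound2)
  then have "a \<noteq> b" using x by blast
  then obtain c where c: "idempotent c" "c \<noteq> 0" "\<And>w. w \<le> c \<Longrightarrow> w \<sqsubseteq> a \<Longrightarrow> w = 0"
    using idempotent_complement[OF a b(1,2)] by blast
  obtain f where f: "additive_on {x. x \<le> c} f" "\<forall>x\<le>c. 0 \<le> f x" "f c = 1"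
    by (rule additive_on_interval_exists[OF c(1,2)])
  define s where "s = positive_part_on {x. x \<le> c} f"
  have J: "sum_ideal {x. x \<le> c}" by (rule sum_ideal_interval[OF c(1)])
  have f_le: "f y \<le> 1" if "y \<le> c" for y
    using additive_on_mono[OF f(1) _ J, of c y] f(2,3) that sum_le_idempotent[OF c(1)] by simp
  have bdd: "bdd_above (f ` {y \<in> {x. x \<le> c}. y \<sqsubseteq> x})" for x
    by (rule bdd_aboveI2[of _ _ 1]) (simp add: f_le)
  note sD = positive_part_upper[OF J f(1) bdd, folded s_def]
    positive_part_least[OF J f(1) bdd, folded s_def]
    positive_part_nonneg[OF J f(1) bdd, folded s_def]
    additive_positive_part[OF J f(1) bdd, folded s_def]
  have le1: "s x \<le> 1" for x by (rule sD(2)) (simp add: f_le)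
  have sc: "s c = 1" using sD(1)[of c c] f(3) le1[of c] by simp
  have "s a \<le> 0"
  proof (rule sD(2))
    fix y assume "y \<in> {x. x \<le> c}" "y \<sqsubseteq> a"
    then have "y = 0" using c(3) by simp
    then show "f y \<le> 0" using additive_on_zero[OF f(1)] by (simp add: zero_least)
  qed
  then have "s a = 0" using sD(3)[of a] by simp
  moreover have "s \<in> state_space"
    using sD(3,4) le1 sc by (auto simp: state_space_def emv_state_iff)
  ultimately show ?thesis by blast
qed

lemma top_if_compact_state_space:
  assumes "compact (state_space :: ('a::emv_algebra \<Rightarrow> real) set)"
  shows "\<exists>t :: 'a. \<forall>x. x \<le> t"
proof -
  \<comment> \<open>Any threshold in [0,1) would do: it must be exceeded by the attained value 1 but
    not by the value 0 of a state vanishing at t.\<close>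
  have "open {s :: 'a \<Rightarrow> real. s a > 1/2}" for a
    by (intro open_Collect_less continuous_intros continuous_on_product_coordinates)
  moreover have "state_space \<subseteq> (\<Union>a\<in>Collect idempotent. {s :: 'a \<Rightarrow> real. s a > 1/2})"
  proof
    fix s :: "'a \<Rightarrow> real" assume "s \<in> state_space"
    then obtain a where "idempotent a" "s a = 1" by (rule state_space_attains)
    then show "s \<in> (\<Union>a\<in>Collect idempotent. {s. s a > 1/2})" by auto
  qed
  ultimately obtain I where I: "I \<subseteq> Collect idempotent" "finite I"
    "state_space \<subseteq> (\<Union>a\<in>I. {s :: 'a \<Rightarrow> real. s a > 1/2})"
    by (rule compactE_image[OF assms])
  have "\<exists>t :: 'a. idempotent t \<and> (\<forall>a\<in>I. a \<le> t)"
    using \<open>finite I\<close>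
  proof (induction I)
    \<comment> \<open>The subcover is empty only if there are no states. Then t is arbitrary, and an
      element not below it would still produce a state.\<close>
    case empty
    show ?case using below_idempotent by blast
  next
    case (insert a I)
    then obtain t where t: "idempotent t" "\<forall>a\<in>I. a \<le> t" by blast
    obtain e where "idempotent e" "a \<le> e" "t \<le> e" by (rule idempotent_bound2)
    then show ?case using t by (intro exI[of _ e]) auto
  qed
  then obtain t where t: "idempotent t" "\<forall>a\<in>I. a \<le> t" by blast
  have "s t > 1/2" if s: "s \<in> state_space" for s
  proof -
    obtain a where "a \<in> I" "s a > 1/2" using I(3) s by blast
    then show ?thesis using state_spaceD(4)[OF s, of a t] t sum_le_idempotent by fastforce
  qed
  then have "x \<le> t" for x using state_vanishing_on_idempotent[OF t(1), of x] by fastforce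
  then show ?thesis by blast
qed

theorem theorem7p1:
  "is_simplex (state_space :: ('a::emv_algebra \<Rightarrow> real) set) \<and>
   ((\<exists>t::'a. \<forall>x. x \<le> t) \<longleftrightarrow> choquet_simplex (state_space :: ('a \<Rightarrow> real) set)) \<and>
   (choquet_simplex (state_space :: ('a \<Rightarrow> real) set) \<longleftrightarrow>
      bauer_simplex (state_space :: ('a \<Rightarrow> real) set))"
  unfolding choquet_simplex_def bauer_simplex_def
  using simplex_state_space compact_state_space compact_extreme_states top_if_compact_state_space
  by blast

end
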